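(* Let $q\ge 2$, $d\ge 2$, $1\le z\le q-1$ be integers with $\gcd(q,z)=1$, let $0<\alpha<1$, and put $\beta=1-\alpha$, $n=qd$, $c=d+z$, and $$f_\alpha(x)=\bigl(x^q-(1-\alpha)\bigr)^d-\alpha^d x^z .$$ An $n\times n$ stochastic matrix has characteristic polynomial $f_\alpha$ if and only if it is permutation-similar to a matrix $A$ indexed by $\mathbb Z_d\times\mathbb Z_q$ whose only nonzero entries are $$A_{(t,i),(t,i+1)}=b_{t,i}\qquad (t\in\{0,\dots,d-1\},\ i\in\mathbb Z_q),$$ $$A_{(t,i),(t+1,i)}=1-b_{t,i}\qquad (t=0,\dots,d-2,\ i\in S_t),$$ $$A_{(d-1,i),(0,i+c)}=1-b_{d-1,i}\qquad (i\in S_{d-1}),$$ where the sets $S_0,\dots,S_{d-1}\subseteq\mathbb Z_q$ and the real numbers $b_{t,i}$ satisfy the following two conditions. (a) There are $a_0,\dots,a_{d-1}\in\mathbb Z_{\ge 0}$ and $\rho\in\mathbb Z_q$ such that $a_0+\cdots+a_{d-1}=z$, $$\varnothing\ne S_0\subseteq[\rho,\rho+a_0]_q,$$ and, for $t=1,\dots,d-1$, $$\varnothing\ne S_t\subseteq\left[\rho-\sum_{j=1}^t(a_j+1),\ \rho-\sum_{j=1}^t(a_j+1)+a_t\right]_q .$$ (b) $b_{t,i}\in(0,1)$ for $i\in S_t$, $b_{t,i}=1$ for $i\notin S_t$, and $$\prod_{i\in S_t}b_{t,i}=\beta,\qquad t=0,\dots,d-1 .$$ (The interval data $(a_0,\dots,a_{d-1},\rho)$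 in (a) need not be unique, but every stochastic matrix with characteristic polynomial $f_\alpha$ admits at least one such presentation.)
   Context: A stochastic matrix is row-stochastic: real nonnegative entries and every row sum equal to $1$. The characteristic polynomial is $\chi_A(x)=\det(xI-A)$. $\mathbb Z_m=\mathbb Z/m\mathbb Z$; $\mathbb Z_d$ is identified with $\{0,\dots,d-1\}$, and second coordinates of index pairs are read modulo $q$. Two $n\times n$ matrices (possibly with different index sets of size $n$) are permutation-similar if one is obtained from the other by a bijective relabelling of indices applied simultaneously to rows and columns. For $a\in\mathbb Z_q$ and an integer $\ell\in\{1,\dots,q\}$, the cyclic interval is $[a,a+\ell-1]_q=\{a,a+1,\dots,a+\ell-1\}\subseteq\mathbb Z_q$ (residues mod $q$). *)

theory Defs
  imports "Jordan_Normal_Form.Char_Poly"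
begin

text \<open>
  Conventions: \<open>\<int>\<^sub>d\<close> is the set of naturals \<open>{..<d}\<close>, and \<open>\<int>\<^sub>q\<close> is the set of
  canonical residues \<open>{0..<int q}\<close> (integers, so that negative shifts such as
  \<open>\<rho> - \<Sum>j. (a j + 1)\<close> are not truncated).
\<close>

definition stochastic_mat :: "real mat \<Rightarrow> bool" where
  "stochastic_mat M \<longleftrightarrow>
     square_mat M \<and>
     (\<forall>i<dim_row M. \<forall>j<dim_col M. 0 \<le> M $$ (i, j)) \<and>
     (\<forall>i<dim_row M. (\<Sum>j<dim_col M. M $$ (i, j)) = 1)"

text \<open>Here a matrix with index set \<open>I\<close> is a function whose values outside \<open>I \<times> I\<close> are irrelevant.\<close>

definition permutation_similar ::
  "'i set \<Rightarrow> ('i \<Rightarrow> 'i \<Rightarrow> 'a) \<Rightarrow> 'j set \<Rightarrow> ('j \<Rightarrow> 'j \<Rightarrow> 'a) \<Rightarrow> bool" where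
  "permutation_similar I A J B \<longleftrightarrow>
     (\<exists>\<phi>. bij_betw \<phi> I J \<and> (\<forall>r\<in>I. \<forall>s\<in>I. A r s = B (\<phi> r) (\<phi> s)))"

definition f_poly :: "nat \<Rightarrow> nat \<Rightarrow> nat \<Rightarrow> real \<Rightarrow> real poly" where
  "f_poly q d z \<alpha> =
     ([:0, 1:] ^ q - [:1 - \<alpha>:]) ^ d - Polynomial.smult (\<alpha> ^ d) ([:0, 1:] ^ z)"

text \<open>The interval \<open>[a, a + l - 1]\<^sub>q\<close>; the second argument \<open>l\<close> is its number of terms.\<close>

definition cyclic_interval :: "nat \<Rightarrow> int \<Rightarrow> nat \<Rightarrow> int set" where
  "cyclic_interval q a l = (\<lambda>k. (a + int k) mod int q) ` {..<l}"

definition interval_data ::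
  "nat \<Rightarrow> nat \<Rightarrow> nat \<Rightarrow> (nat \<Rightarrow> int set) \<Rightarrow> (nat \<Rightarrow> nat) \<Rightarrow> int \<Rightarrow> bool" where
  "interval_data q d z S a \<rho> \<longleftrightarrow>
     \<rho> \<in> {0..<int q} \<and>
     (\<Sum>t<d. a t) = z \<and>
     S 0 \<noteq> {} \<and> S 0 \<subseteq> cyclic_interval q \<rho> (a 0 + 1) \<and>
     (\<forall>t\<in>{1..<d}. S t \<noteq> {} \<and>
        S t \<subseteq> cyclic_interval q (\<rho> - (\<Sum>j=1..t. int (a j + 1))) (a t + 1))"

definition weight_condition ::
  "nat \<Rightarrow> nat \<Rightarrow> real \<Rightarrow> (nat \<Rightarrow> int set) \<Rightarrow> (nat \<Rightarrow> int \<Rightarrow> real) \<Rightarrow> bool" where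
  "weight_condition q d \<beta> S b \<longleftrightarrow>
     (\<forall>t<d. (\<forall>i\<in>S t. 0 < b t i \<and> b t i < 1) \<and>
            (\<forall>i\<in>{0..<int q} - S t. b t i = 1) \<and>
            (\<Prod>i\<in>S t. b t i) = \<beta>)"

text \<open>For \<open>d \<ge> 2\<close> at most one of the three conditions holds for any pair of indices.\<close>

definition cyclic_mat ::
  "nat \<Rightarrow> nat \<Rightarrow> nat \<Rightarrow> (nat \<Rightarrow> int set) \<Rightarrow> (nat \<Rightarrow> int \<Rightarrow> real) \<Rightarrow>
   nat \<times> int \<Rightarrow> nat \<times> int \<Rightarrow> real" where
  "cyclic_mat q d c S b = (\<lambda>(t, i) (t', i').
     if t' = t \<and> i' = (i + 1) mod int q then b t i
     else if t < d - 1 \<and> i \<in> S t \<and> t' = t + 1 \<and> i' = i then 1 - b t i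
     else if t = d - 1 \<and> i \<in> S t \<and> t' = 0 \<and> i' = (i + int c) mod int q then 1 - b t i
     else 0)"

end

theory Submission
  imports Defs "Jordan_Normal_Form.Schur_Decomposition" "HOL-Computational_Algebra.Polynomial_FPS"
begin

text \<open>
  By Newton's identities, \<open>\<chi>\<^sub>A = (x\<^sup>q - \<beta>)\<^sup>d - w x\<^sup>z\<close> says precisely that, for \<open>1 \<le> k \<le> n\<close>,
  the trace of \<open>A\<^sup>k\<close> is \<open>n \<beta>\<^bsup>k/q\<^esup>\<close> if \<open>q\<close> divides \<open>k\<close>, plus \<open>(n - z) w\<close> if \<open>k = n - z\<close>, and
  \<open>0\<close> otherwise. For a stochastic matrix \<open>\<chi>\<^sub>A(1) = 0\<close> then forces \<open>w = \<alpha>\<^sup>d\<close>.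

  If \<open>A\<close> has the cyclic form, an integer potential shows that a closed walk leaving a level has
  length \<open>q e + (n - z) w\<close> with \<open>w \<ge> 1\<close>. So up to length \<open>n\<close> only the \<open>q\<close>-cycles
  of the levels and closed walks of length \<open>n - z\<close> contribute to the traces.

  Conversely, Cauchy--Schwarz is an equality for the diagonal of \<open>A\<^sup>q\<close>, since the traces of
  \<open>A\<^sup>q\<close> and \<open>A\<^bsup>2q\<^esup>\<close> are \<open>n \<beta>\<close> and \<open>n \<beta>\<^sup>2\<close>. Hence every index lies on exactly one closed walk
  of length \<open>q\<close>, of weight \<open>\<beta>\<close>, and the indices split into \<open>d\<close> disjoint \<open>q\<close>-cycles. Their loops
  use up all traces except the one at \<open>n - z\<close>, so every closed walk of length at most \<open>n\<close> with an
  edge between two cycles has length exactly \<open>n - z\<close>. As a closed walk through \<open>k\<close> cycles can be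
  shortened to length at most \<open>k q\<close>, the cycles are arranged in one ring of \<open>d\<close> levels. Comparing
  the lengths of the closed walks that go around this ring gives the shape of the exit edges, and
  the intervals are read off from a choice of exits that minimises every step of such a walk.
\<close>

section \<open>Newton's identities and the traces of powers\<close>

definition trace_pow :: "'a::semiring_1 mat \<Rightarrow> nat \<Rightarrow> 'a" where
  "trace_pow A k = (\<Sum>i<dim_row A. (A ^\<^sub>m k) $$ (i, i))"

lemma trace_mult_commute:
  fixes A B :: "'a::comm_semiring_1 mat"
  assumes "A \<in> carrier_mat n n" "B \<in> carrier_mat n n"
  shows "(\<Sum>i<n. (A * B) $$ (i, i)) = (\<Sum>i<n. (B * A) $$ (i, i))"
proof -
  have "(\<Sum>i<n. (A * B) $$ (i, i)) = (\<Sum>i<n. \<Sum>j<n. A $$ (i, j) * B $$ (j, i))"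
    using assms by (intro sum.cong refl) (auto simp: scalar_prod_def lessThan_atLeast0)
  also have "\<dots> = (\<Sum>j<n. \<Sum>i<n. B $$ (j, i) * A $$ (i, j))"
    by (subst sum.swap) (simp add: mult.commute)
  also have "\<dots> = (\<Sum>i<n. (B * A) $$ (i, i))"
    using assms by (intro sum.cong refl) (auto simp: scalar_prod_def lessThan_atLeast0)
  finally show ?thesis .
qed

text \<open>The diagonal and the part below it are handled together, since the diagonal entry of the
  next power is computed from the zeros below the diagonal.\<close>

lemma upper_triangular_pow:
  fixes B :: "'a::comm_semiring_1 mat"
  assumes B: "B \<in> carrier_mat n n" and ut: "upper_triangular B"
  shows "i < n \<Longrightarrow> j \<le> i \<Longrightarrow> (B ^\<^sub>m k) $$ (i, j) = (if i = j then (B $$ (i, i)) ^ k else 0)"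
proof (induction k arbitrary: i j)
  case 0
  then show ?case using B by auto
next
  case (Suc k)
  have "(B ^\<^sub>m Suc k) $$ (i, j) = (\<Sum>l<n. (B ^\<^sub>m k) $$ (i, l) * B $$ (l, j))"
    using Suc.prems B by (auto simp: scalar_prod_def lessThan_atLeast0)
  also have "\<dots> = (\<Sum>l<n. if l = i then (if i = j then (B $$ (i, i)) ^ Suc k else 0) else 0)"
  proof (intro sum.cong refl)
    fix l assume l: "l \<in> {..<n}"
    consider "l < i" | "l = i" | "l > i" by linarith
    then show "(B ^\<^sub>m k) $$ (i, l) * B $$ (l, j) =
        (if l = i then (if i = j then (B $$ (i, i)) ^ Suc k else 0) else 0)"
    proof cases
      case 1
      then show ?thesis using Suc.IH[of i l] Suc.prems by simp
    next
      case 2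
      have "j < i \<Longrightarrow> B $$ (i, j) = 0"
        using ut B Suc.prems by (auto simp: upper_triangular_def)
      then show ?thesis using Suc.IH[of i i] Suc.prems 2 by (auto simp: mult.commute)
    next
      case 3
      then have "B $$ (l, j) = 0"
        using ut B Suc.prems l by (auto simp: upper_triangular_def)
      then show ?thesis using 3 by simp
    qed
  qed
  also have "\<dots> = (if i = j then (B $$ (i, i)) ^ Suc k else 0)"
    using Suc.prems by simp
  finally show ?case .
qed

text \<open>Schur triangularisation over the complex numbers; the cyclic property of the trace
  removes the conjugating matrices, and the list \<open>es\<close> carries the
  multiplicities.\<close>

lemma trace_pow_eigenvalues:
  fixes A :: "complex mat"
  assumes A: "A \<in> carrier_mat n n"
  obtains es where "char_poly A = (\<Prod>e\<leftarrow>es. [:- e, 1:])" "length es = n"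
    "\<And>k. trace_pow A k = (\<Sum>e\<leftarrow>es. e ^ k)"
proof -
  from char_poly_factorized[OF A] obtain as where "char_poly A = (\<Prod>a\<leftarrow>as. [:- a, 1:])" by blast
  from schur_decomposition_exists[OF A this] obtain B where
    B: "B \<in> carrier_mat n n" "upper_triangular B" "similar_mat A B" by blast
  from B(3) obtain P Q where wit: "similar_mat_wit A B P Q" unfolding similar_mat_def by blast
  note w = similar_mat_witD2[OF A wit]
  have "trace_pow A k = (\<Sum>e\<leftarrow>diag_mat B. e ^ k)" for k
  proof -
    have Bk: "B ^\<^sub>m k \<in> carrier_mat n n" using B by simp
    have "trace_pow A k = (\<Sum>i<n. (P * (B ^\<^sub>m k * Q)) $$ (i, i))"
      unfolding trace_pow_def similar_mat_wit_pow_id[OF wit]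
      using A w Bk by (simp add: assoc_mult_mat[of _ n n _ n _ n])
    also have "\<dots> = (\<Sum>i<n. (B ^\<^sub>m k * Q * P) $$ (i, i))"
      by (rule trace_mult_commute) (use w Bk in auto)
    also have "\<dots> = (\<Sum>i<n. (B ^\<^sub>m k) $$ (i, i))"
      using w Bk by (simp add: assoc_mult_mat[of _ n n _ n _ n])
    also have "\<dots> = (\<Sum>i<n. (B $$ (i, i)) ^ k)"
      by (intro sum.cong refl) (simp add: upper_triangular_pow[OF B(1,2)])
    also have "\<dots> = (\<Sum>e\<leftarrow>diag_mat B. e ^ k)"
      using B(1) by (simp add: diag_mat_def comp_def interv_sum_list_conv_sum_set_nat lessThan_atLeast0)
    finally show ?thesis .
  qed
  moreover have "char_poly A = (\<Prod>e\<leftarrow>diag_mat B. [:- e, 1:])"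
    using char_poly_similar[OF B(3)] char_poly_upper_triangular[OF B(1,2)] by simp
  moreover have "length (diag_mat B) = n" using B(1) by (simp add: diag_mat_def)
  ultimately show ?thesis using that by blast
qed

section \<open>Newton's identities for formal power series\<close>

text \<open>This is the logarithmic derivative of the product of the \<open>1 - e X\<close>, with
  the denominator cleared.\<close>

lemma newton_linear_factors:
  fixes es :: "'a::field list"
  shows "Abs_fps (\<lambda>k. if k = 0 then 0 else \<Sum>e\<leftarrow>es. e ^ k)
      * (\<Prod>e\<leftarrow>es. 1 - fps_const e * fps_X)
    + fps_X * fps_deriv (\<Prod>e\<leftarrow>es. 1 - fps_const e * fps_X) = 0"
proof (induction es)
  case Nil
  then show ?case by (simp add: fps_eq_iff)
next
  case (Cons e es)
  define P where "P = Abs_fps (\<lambda>k. if k = 0 then 0 else \<Sum>e\<leftarrow>es. e ^ k)"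
  define R where "R = (\<Prod>e\<leftarrow>es. 1 - fps_const e * fps_X)"
  define E where "E = Abs_fps (\<lambda>k. if k = 0 then 0 else e ^ k)"
  define L where "L = 1 - fps_const e * fps_X"
  have IH: "P * R + fps_X * fps_deriv R = 0" using Cons P_def R_def by simp
  have EP: "Abs_fps (\<lambda>k. if k = 0 then 0 else \<Sum>e\<leftarrow>e # es. e ^ k) = E + P"
    by (simp add: E_def P_def fps_eq_iff)
  \<comment> \<open>\<open>E\<close> is the geometric series \<open>e X / (1 - e X)\<close>.\<close>
  have EL: "E * L = fps_const e * fps_X"
  proof (rule fps_ext)
    fix k
    have "E * L = E - fps_const e * (fps_X * E)"
      by (simp add: L_def algebra_simps)
    then have "fps_nth (E * L) k = fps_nth E k - e * fps_nth (fps_X * E) k"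
      by (simp add: fps_mult_left_const_nth)
    then show "fps_nth (E * L) k = fps_nth (fps_const e * fps_X) k"
      by (cases k; cases "k - 1") (auto simp: E_def)
  qed
  have dL: "fps_X * fps_deriv L = - (E * L)" unfolding EL by (simp add: L_def flip: fps_const_neg)
  \<comment> \<open>By the product rule the relation for \<open>L * R\<close> is the one for
    \<open>L\<close> times \<open>R\<close> plus \<open>L\<close> times the one for
    \<open>R\<close>.\<close>
  have "(E + P) * (L * R) + fps_X * fps_deriv (L * R)
      = (E * L + fps_X * fps_deriv L) * R + L * (P * R + fps_X * fps_deriv R)"
    by (simp add: algebra_simps)
  then have "(E + P) * (L * R) + fps_X * fps_deriv (L * R) = L * (P * R + fps_X * fps_deriv R)"
    unfolding dL by simp
  then show ?case
    unfolding IH EP by (simp add: L_def R_def)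
qed

text \<open>Newton's identities up to degree \<open>n\<close>, with power sums \<open>p\<close> and elementary symmetric
  functions \<open>r\<close> (including their signs).\<close>

definition newton_rel :: "nat \<Rightarrow> 'a::field fps \<Rightarrow> 'a fps \<Rightarrow> bool" where
  "newton_rel n p r \<longleftrightarrow> fps_nth p 0 = 0 \<and> fps_nth r 0 = 1 \<and> (\<forall>k\<le>n. fps_nth (p * r + fps_X * fps_deriv r) k = 0)"

text \<open>In the convolution the term \<open>j = 0\<close> vanishes and the term
  \<open>j = k\<close> is the power sum itself; the derivative contributes \<open>k\<close> times
  the coefficient of \<open>r\<close>.\<close>

lemma newton_rel_nth:
  assumes "newton_rel n p r" "k \<le> n" "k > 0"
  shows "of_nat k * fps_nth r k + fps_nth p k + (\<Sum>j\<in>{1..<k}. fps_nth p j * fps_nth r (k - j)) = 0"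
proof -
  obtain m where k: "k = Suc m" using assms(3) by (cases k) auto
  have X: "fps_nth (fps_X * fps_deriv r) k = of_nat k * fps_nth r k"
    by (simp add: k)
  have "fps_nth (p * r + fps_X * fps_deriv r) k = (\<Sum>j=0..k. fps_nth p j * fps_nth r (k - j)) + of_nat k * fps_nth r k"
    by (simp only: fps_add_nth fps_mult_nth[of p r] X)
  also have "{0..k} = insert 0 (insert k {1..<k})" using assms(3) by auto
  also have "(\<Sum>j\<in>\<dots>. fps_nth p j * fps_nth r (k - j)) = fps_nth p k + (\<Sum>j\<in>{1..<k}. fps_nth p j * fps_nth r (k - j))"
    using assms by (simp add: newton_rel_def)
  finally show ?thesis using assms unfolding newton_rel_def by (metis add.commute add.left_commute)
qed

text \<open>The recursion is triangular: the earlier coefficients and one of the two coefficients at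
  \<open>k\<close> determine the other. Characteristic 0 allows the division by
  \<open>k\<close>.\<close>

lemma newton_rel_unique:
  fixes p p' r r' :: "'a::field_char_0 fps"
  assumes "newton_rel n p r" "newton_rel n p' r'"
  shows "(\<forall>k\<le>n. fps_nth p k = fps_nth p' k) \<longleftrightarrow> (\<forall>k\<le>n. fps_nth r k = fps_nth r' k)"
proof
  assume p: "\<forall>k\<le>n. fps_nth p k = fps_nth p' k"
  show "\<forall>k\<le>n. fps_nth r k = fps_nth r' k"
  proof (intro allI impI)
    fix k assume "k \<le> n" then show "fps_nth r k = fps_nth r' k"
    proof (induction k rule: less_induct)
      case (less k)
      show ?case
      proof (cases "k = 0")
        case True
        then show ?thesis using assms by (simp add: newton_rel_def)
      next
        case False
        have "(\<Sum>j\<in>{1..<k}. fps_nth p j * fps_nth r (k - j)) = (\<Sum>j\<in>{1..<k}. fps_nth p' j * fps_nth r' (k - j))"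
          using less p by (intro sum.cong refl) auto
        moreover have "fps_nth p k = fps_nth p' k" using p less.prems by blast
        ultimately have "of_nat k * fps_nth r k = of_nat k * fps_nth r' k"
          using newton_rel_nth[OF assms(1) less.prems] newton_rel_nth[OF assms(2) less.prems] False
          unfolding add.assoc by (simp add: add_eq_0_iff2)
        then show ?thesis using False by simp
      qed
    qed
  qed
next
  assume r: "\<forall>k\<le>n. fps_nth r k = fps_nth r' k"
  show "\<forall>k\<le>n. fps_nth p k = fps_nth p' k"
  proof (intro allI impI)
    fix k assume "k \<le> n" then show "fps_nth p k = fps_nth p' k"
    proof (induction k rule: less_induct)
      case (less k)
      show ?case
      proof (cases "k = 0")
        case True
        then show ?thesis using assms by (simp add: newton_rel_def)
      next
        case False
        have "(\<Sum>j\<in>{1..<k}. fps_nth p j * fps_nth r (k - j)) = (\<Sum>j\<in>{1..<k}. fps_nth p' j * fps_nth r' (k - j))"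
          using less r by (intro sum.cong refl) auto
        moreover have "fps_nth r k = fps_nth r' k" using r less.prems by blast
        ultimately have "of_nat k * fps_nth r k + fps_nth p k = of_nat k * fps_nth r k + fps_nth p' k"
          using newton_rel_nth[OF assms(1) less.prems] newton_rel_nth[OF assms(2) less.prems] False
          by (simp add: add_eq_0_iff2)
        then show ?thesis by simp
      qed
    qed
  qed
qed

text \<open>Reversal turns the factors \<open>x - e\<close> into \<open>1 - e x\<close>, and the
  leading coefficient 1 into the constant term 1.\<close>

lemma newton_char_poly:
  fixes A :: "complex mat"
  assumes A: "A \<in> carrier_mat n n"
  shows "newton_rel n (Abs_fps (\<lambda>k. if k = 0 then 0 else trace_pow A k))
    (fps_of_poly (reflect_poly (char_poly A)))"
proof -
  obtain es where es: "char_poly A = (\<Prod>e\<leftarrow>es. [:- e, 1:])" "length es = n"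
    "\<And>k. trace_pow A k = (\<Sum>e\<leftarrow>es. e ^ k)" using trace_pow_eigenvalues[OF A] by metis
  have "reflect_poly [:- e, 1:] = [:1, - e:]" for e :: complex
    by (simp add: reflect_poly_def)
  then have "reflect_poly (char_poly A) = (\<Prod>e\<leftarrow>es. [:1, - e:])"
    unfolding es(1) reflect_poly_prod_list by (simp add: comp_def)
  moreover have lin: "fps_of_poly [:1, - e:] = 1 - fps_const e * fps_X" for e :: complex
    by (simp add: fps_of_poly_pCons mult.commute flip: fps_const_neg)
  ultimately have "fps_of_poly (reflect_poly (char_poly A)) = (\<Prod>e\<leftarrow>es. 1 - fps_const e * fps_X)"
    by (simp only: fps_of_poly_prod_list map_map comp_def lin)
  moreover have "fps_nth (fps_of_poly (reflect_poly (char_poly A))) 0 = 1"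
    using degree_monic_char_poly[OF A] by simp
  ultimately show ?thesis
    using newton_linear_factors[of es] unfolding newton_rel_def es(3)
    by (auto simp only: fps_nth_Abs_fps fps_zero_nth simp_thms if_True)
qed


text \<open>The eigenvalues are complex, so the relation is proved there and pulled back along the
  injective homomorphism \<open>of_real\<close>.\<close>

lemma newton_char_poly_real:
  fixes A :: "real mat"
  assumes A: "A \<in> carrier_mat n n"
  shows "newton_rel n (Abs_fps (\<lambda>k. if k = 0 then 0 else trace_pow A k))
    (fps_of_poly (reflect_poly (char_poly A)))"
proof -
  define B where "B = map_mat complex_of_real A"
  have B: "B \<in> carrier_mat n n" using A by (simp add: B_def)
  have pow: "B ^\<^sub>m k = map_mat complex_of_real (A ^\<^sub>m k)" for k
    unfolding B_def by (rule of_real_hom.mat_hom_pow[symmetric, OF A])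
  have tr: "trace_pow B k = of_real (trace_pow A k)" for k
    using A B by (simp add: trace_pow_def pow)
  have cp: "char_poly B = map_poly of_real (char_poly A)"
    unfolding B_def by (rule of_real_hom.char_poly_hom[OF A])
  define p r where "p = Abs_fps (\<lambda>k. if k = 0 then 0 else trace_pow A k)"
    and "r = fps_of_poly (reflect_poly (char_poly A))"
  define p' r' where "p' = Abs_fps (\<lambda>k. if k = 0 then 0 else trace_pow B k)"
    and "r' = fps_of_poly (reflect_poly (char_poly B))"
  have p': "fps_nth p' k = of_real (fps_nth p k)" for k by (simp add: p'_def p_def tr)
  have r': "fps_nth r' k = of_real (fps_nth r k)" for k
    by (simp add: r'_def r_def cp coeff_reflect_poly)
  have "newton_rel n p' r'" unfolding p'_def r'_def by (rule newton_char_poly[OF B])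
  moreover have E: "fps_nth (p' * r' + fps_X * fps_deriv r') k
      = of_real (fps_nth (p * r + fps_X * fps_deriv r) k)" for k
    by (cases k) (simp_all add: fps_mult_nth[of p'] fps_mult_nth[of p] p' r')
  ultimately have "newton_rel n p r" unfolding newton_rel_def E p' r'
    by (simp only: of_real_eq_0_iff of_real_eq_1_iff) simp
  then show ?thesis by (simp add: p_def r_def)
qed

section \<open>The target polynomial and its power sums\<close>

text \<open>The parameter \<open>w\<close> can later be defined by a trace; \<open>f_poly\<close> is
  the case \<open>b = 1 - \<alpha>\<close>, \<open>w = \<alpha> ^ d\<close>.\<close>

definition target_poly :: "nat \<Rightarrow> nat \<Rightarrow> nat \<Rightarrow> 'a::comm_ring_1 \<Rightarrow> 'a \<Rightarrow> 'a poly" where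
  "target_poly q d z b w = ([:0, 1:] ^ q - [:b:]) ^ d - Polynomial.smult w ([:0, 1:] ^ z)"

text \<open>These are the power sums of the roots of \<open>target_poly\<close> for
  \<open>1 \<le> k \<le> q * d\<close>; this is the content of \<open>newton_target\<close>.\<close>

definition target_trace :: "nat \<Rightarrow> nat \<Rightarrow> nat \<Rightarrow> 'a::comm_ring_1 \<Rightarrow> 'a \<Rightarrow> nat \<Rightarrow> 'a" where
  "target_trace q d z b w k = (if q dvd k then of_nat (q * d) * b ^ (k div q) else 0)
     + (if k = q * d - z then of_nat (q * d - z) * w else 0)"

lemma degree_target_poly:
  fixes b w :: "'a::field"
  assumes "q > 0" "z < q * d"
  shows "degree (target_poly q d z b w) = q * d" "lead_coeff (target_poly q d z b w) = 1"
proof -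
  have degX: "degree ([:0, 1::'a:] ^ q) = q" by (simp add: degree_power_eq)
  then have deg1: "degree ([:0, 1:] ^ q + [:- b:]) = q"
    using assms by (subst degree_add_eq_left) auto
  have "coeff ([:0, 1:] ^ q + [:- b:]) q = 1"
    using assms lead_coeff_power[of "[:0, 1::'a:]" q] unfolding degX
    by (simp add: coeff_pCons split: nat.splits)
  then have lc1: "lead_coeff ([:0, 1:] ^ q + [:- b:]) = 1" by (simp only: deg1)
  define P where "P = ([:0, 1:] ^ q + [:- b:]) ^ d"
  have "[:0, 1:] ^ q + [:- b:] \<noteq> 0" using deg1 assms by fastforce
  then have degP: "degree P = q * d" unfolding P_def by (simp add: degree_power_eq deg1)
  have lcP: "lead_coeff P = 1" unfolding P_def lead_coeff_power lc1 by simp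
  define Q where "Q = - Polynomial.smult w ([:0, 1:] ^ z)"
  have "degree Q \<le> z"
    unfolding Q_def using degree_smult_le[of w "[:0, 1:] ^ z"] by (simp add: degree_power_eq)
  then have lt: "degree Q < degree P" using degP assms by simp
  have "[:- b:] = - [:b:]" by simp
  then have t: "target_poly q d z b w = P + Q"
    by (simp only: target_poly_def P_def Q_def add_uminus_conv_diff)
  show "degree (target_poly q d z b w) = q * d" unfolding t using degree_add_eq_left[OF lt] degP by simp
  show "lead_coeff (target_poly q d z b w) = 1" unfolding t using lead_coeff_add_le[OF lt] lcP
    by (simp add: add.commute)
qed

text \<open>Both sides are compared as functions, which suffices over an infinite field; for
  \<open>x \<noteq> 0\<close> the reflected polynomial is \<open>x ^ (q * d)\<close> times the value
  at \<open>inverse x\<close>.\<close>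

lemma reflect_target_poly:
  fixes b w :: "'a::field_char_0"
  assumes "q > 0" "z < q * d"
  shows "reflect_poly (target_poly q d z b w)
    = (1 - Polynomial.smult b ([:0, 1:] ^ q)) ^ d - Polynomial.smult w ([:0, 1:] ^ (q * d - z))"
    (is "?l = ?r")
proof -
  note deg = degree_target_poly[OF assms, of b w]
  have "poly ?l x = poly ?r x" for x
  proof (cases "x = 0")
    case True
    then show ?thesis using deg assms by (simp add: power_0_left)
  next
    case False
    have "x ^ (q * d) = (x ^ q) ^ d" by (simp add: power_mult)
    moreover have "x ^ (q * d) * inverse x ^ z = x ^ (q * d - z)"
      using assms False by (simp add: power_diff divide_inverse power_inverse)
    moreover have "x ^ q * (inverse x ^ q - b) = 1 - b * x ^ q"
      using False by (simp add: algebra_simps flip: power_mult_distrib)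
    then have "(x ^ q) ^ d * (inverse x ^ q - b) ^ d = (1 - b * x ^ q) ^ d"
      by (metis power_mult_distrib)
    ultimately show ?thesis
      unfolding poly_reflect_poly_nz[OF False] deg
      by (simp add: target_poly_def algebra_simps)
  qed
  then show ?thesis by (simp add: poly_eq_poly_eq_iff[symmetric] ext)
qed

text \<open>The power sums of \<open>L ^ d\<close> are exact, and \<open>m w X^m\<close> is the
  first-order correction for subtracting \<open>w X^m\<close>. All remaining products have order
  above \<open>q * d\<close>.\<close>

lemma newton_target:
  fixes b w :: "'a::field_char_0"
  assumes "q > 0" "0 < z" "z < q" "d \<ge> 2"
  shows "newton_rel (q * d) (Abs_fps (\<lambda>k. if k = 0 then 0 else target_trace q d z b w k))
    (fps_of_poly (reflect_poly (target_poly q d z b w)))"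
proof -
  define m where "m = q * d - z"
  have "2 * q \<le> q * d" using assms by simp
  then have zn: "z < q * d" and m: "m > 0" "m + z = q * d" "2 * m > q * d"
    using assms unfolding m_def by linarith+
  define L where "L = 1 - fps_const b * fps_X ^ q"
  define R where "R = L ^ d - fps_const w * fps_X ^ m"
  have R: "fps_of_poly (reflect_poly (target_poly q d z b w)) = R"
    unfolding reflect_target_poly[OF assms(1) zn]
    by (simp add: R_def L_def m_def fps_of_poly_diff fps_of_poly_power fps_of_poly_smult)
  define P where "P = Abs_fps (\<lambda>k. if k = 0 then 0 else target_trace q d z b w k)"
  \<comment> \<open>\<open>H\<close> is \<open>q d b / (1 - b X^q)\<close>, so \<open>X^q H\<close>
    collects the power sums belonging to \<open>L ^ d\<close>.\<close>
  define H where "H = Abs_fps (\<lambda>k. if q dvd k then of_nat (q * d) * b ^ (Suc (k div q)) else 0 :: 'a)"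
  have HL: "H * L = fps_const (of_nat (q * d) * b)"
  proof (rule fps_ext)
    fix k
    have "H * L = H - fps_const b * (fps_X ^ q * H)" by (simp add: L_def algebra_simps)
    then have "fps_nth (H * L) k = fps_nth H k - b * (if k < q then 0 else fps_nth H (k - q))"
      by (simp add: fps_mult_left_const_nth fps_X_power_mult_nth)
    also have "\<dots> = fps_nth (fps_const (of_nat (q * d) * b)) k"
    proof (cases "k < q")
      case True
      then show ?thesis by (auto simp: H_def dest: dvd_imp_le)
    next
      case False
      then obtain j where k: "k = q + j" using le_Suc_ex not_less by metis
      have "k div q = Suc (j div q)" using assms(1) by (simp add: k)
      then show ?thesis using assms(1) by (simp add: H_def k)
    qed
    finally show "fps_nth (H * L) k = fps_nth (fps_const (of_nat (q * d) * b)) k" .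
  qed
  have P: "P = fps_X ^ q * H + fps_const (of_nat m * w) * fps_X ^ m"
  proof (rule fps_ext)
    fix k
    have X: "fps_nth (fps_X ^ q * H) k = (if k = 0 then 0 else if q dvd k then of_nat (q * d) * b ^ (k div q) else 0)"
    proof (cases "k < q")
      case True
      then show ?thesis using assms(1) by (auto simp: fps_X_power_mult_nth dest: dvd_imp_le)
    next
      case False
      then obtain j where k: "k = q + j" using le_Suc_ex not_less by metis
      have "k div q = Suc (j div q)" using assms(1) by (simp add: k)
      then show ?thesis using assms(1) by (simp add: fps_X_power_mult_nth H_def k)
    qed
    show "fps_nth P k = fps_nth (fps_X ^ q * H + fps_const (of_nat m * w) * fps_X ^ m) k"
      using m(1) unfolding fps_add_nth X by (auto simp: P_def target_trace_def m_def fps_X_power_nth)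
  qed
  have Xd: "fps_X * fps_deriv (fps_X ^ j) = fps_const (of_nat j) * (fps_X ^ j :: 'a fps)" for j
  proof (rule fps_ext)
    fix k
    show "fps_nth (fps_X * fps_deriv (fps_X ^ j)) k = fps_nth (fps_const (of_nat j) * (fps_X ^ j :: 'a fps)) k"
      by (cases k) (auto simp: fps_X_power_nth fps_mult_left_const_nth simp del: fps_deriv_power)
  qed
  have dL: "fps_X * fps_deriv L = - (fps_const (of_nat q * b) * fps_X ^ q)"
  proof -
    have "fps_X * fps_deriv L = - (fps_const b * (fps_X * fps_deriv (fps_X ^ q)))"
      by (simp add: L_def algebra_simps)
    then show ?thesis unfolding Xd by (simp add: mult.assoc[symmetric] mult.commute[of b])
  qed
  obtain e where d: "d = Suc e" using assms by (cases d) auto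
  have dLd: "fps_X * fps_deriv (L ^ d) = - (fps_X ^ q * H * L ^ d)"
  proof -
    have "fps_X * fps_deriv (L ^ d) = of_nat d * L ^ e * (fps_X * fps_deriv L)"
      by (simp only: d fps_deriv_power diff_Suc_1 fps_of_nat mult_ac)
    also have "\<dots> = - (fps_X ^ q * L ^ e * fps_const (of_nat (q * d) * b))"
      unfolding dL by (simp add: algebra_simps flip: fps_of_nat fps_const_mult)
    also have "\<dots> = - (fps_X ^ q * L ^ e * (H * L))" by (simp only: HL)
    also have "\<dots> = - (fps_X ^ q * H * L ^ d)" by (simp add: d mult_ac)
    finally show ?thesis .
  qed
  \<comment> \<open>The cofactor shows that \<open>L ^ d - 1\<close> has order at least
    \<open>q\<close>, hence its product with \<open>X^m\<close> order at least
    \<open>m + q\<close>.\<close>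
  define G where "G = - fps_const b * (\<Sum>i<d. L ^ i)"
  have "L ^ d - 1 = (L - 1) * (\<Sum>i<d. L ^ i)" by (rule power_diff_1_eq)
  also have "L - 1 = - fps_const b * fps_X ^ q" by (simp add: L_def)
  also have "\<dots> * (\<Sum>i<d. L ^ i) = fps_X ^ q * G" unfolding G_def by (simp only: mult_ac)
  finally have G: "L ^ d = 1 + fps_X ^ q * G" by (simp only: diff_eq_eq add.commute)
  have "P * R + fps_X * fps_deriv R =
      (fps_X ^ q * H * L ^ d + fps_X * fps_deriv (L ^ d))
      + fps_const (of_nat m * w) * fps_X ^ m * L ^ d - fps_X ^ q * H * fps_const w * fps_X ^ m
      - fps_const (of_nat m * w) * fps_X ^ m * fps_const w * fps_X ^ m
      - fps_const w * (fps_X * fps_deriv (fps_X ^ m))"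
    by (simp add: P R_def algebra_simps)
  also have "\<dots> = fps_const (of_nat m * w) * fps_X ^ m * (L ^ d - 1)
      - fps_X ^ q * H * fps_const w * fps_X ^ m
      - fps_const (of_nat m * w) * fps_X ^ m * fps_const w * fps_X ^ m"
    by (simp only: dLd Xd) (simp add: algebra_simps flip: fps_const_mult)
  also have "L ^ d - 1 = fps_X ^ q * G" by (simp add: G)
  also have "fps_const (of_nat m * w) * fps_X ^ m * (fps_X ^ q * G)
      - fps_X ^ q * H * fps_const w * fps_X ^ m
      - fps_const (of_nat m * w) * fps_X ^ m * fps_const w * fps_X ^ m
      = fps_X ^ (m + q) * (fps_const (of_nat m * w) * G - H * fps_const w)
      - fps_X ^ (2 * m) * (fps_const (of_nat m * w) * fps_const w)"
    unfolding mult_2 power_add right_diff_distrib by (simp only: mult_ac)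
  \<comment> \<open>Here \<open>m + q > q * d\<close> because \<open>z < q\<close>, and
    \<open>2 * m > q * d\<close>.\<close>
  finally have "\<forall>k\<le>q * d. fps_nth (P * R + fps_X * fps_deriv R) k = 0"
    using m assms by (simp add: fps_X_power_mult_nth)
  moreover have "fps_nth R 0 = 1"
    using assms m(1) by (simp add: R_def L_def fps_X_power_nth fps_nth_power_0 power_0_left)
  ultimately show ?thesis unfolding R newton_rel_def P_def[symmetric] by (simp add: P_def)
qed

text \<open>Both polynomials are monic of degree \<open>q * d\<close>, so the low coefficients of
  their reflections decide equality; \<open>newton_rel_unique\<close> trades these for power
  sums.\<close>

theorem char_poly_eq_target_iff:
  fixes A :: "real mat"
  assumes A: "A \<in> carrier_mat (q * d) (q * d)" and q: "q > 0" "0 < z" "z < q" "d \<ge> 2"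
  shows "char_poly A = target_poly q d z b w \<longleftrightarrow>
    (\<forall>k\<in>{1..q * d}. trace_pow A k = target_trace q d z b w k)"
proof -
  define n where "n = q * d"
  have "2 * q \<le> q * d" using q by simp
  then have zn: "z < q * d" using q by linarith
  note deg = degree_target_poly[OF q(1) zn, of b w] degree_monic_char_poly[OF A]
  have nth: "fps_nth (fps_of_poly (reflect_poly p)) k = coeff p (n - k)"
    if "degree p = n" "k \<le> n" for p :: "real poly" and k
    using that by (simp add: coeff_reflect_poly)
  have "char_poly A = target_poly q d z b w \<longleftrightarrow>
      (\<forall>k\<le>n. coeff (char_poly A) (n - k) = coeff (target_poly q d z b w) (n - k))" (is "_ \<longleftrightarrow> ?R")
  proof
    assume R: ?R
    show "char_poly A = target_poly q d z b w"
    proof (rule poly_eqI)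
      fix i
      show "coeff (char_poly A) i = coeff (target_poly q d z b w) i"
      proof (cases "i \<le> n")
        case True
        then show ?thesis using R[rule_format, of "n - i"] by simp
      next
        case False
        then show ?thesis using deg by (simp add: coeff_eq_0 n_def)
      qed
    qed
  qed simp
  also have "\<dots> \<longleftrightarrow> (\<forall>k\<le>n. fps_nth (fps_of_poly (reflect_poly (char_poly A))) k
      = fps_nth (fps_of_poly (reflect_poly (target_poly q d z b w))) k)"
    using nth[of "char_poly A"] nth[of "target_poly q d z b w"] deg by (simp add: n_def)
  also have "\<dots> \<longleftrightarrow> (\<forall>k\<le>n. fps_nth (Abs_fps (\<lambda>k. if k = 0 then 0 else trace_pow A k)) k
      = fps_nth (Abs_fps (\<lambda>k. if k = 0 then 0 else target_trace q d z b w k)) k)"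
    unfolding n_def
    by (rule newton_rel_unique[symmetric, OF newton_char_poly_real[OF A] newton_target[OF q]])
  also have "\<dots> \<longleftrightarrow> (\<forall>k\<in>{1..q * d}. trace_pow A k = target_trace q d z b w k)"
    by (auto simp: n_def)
  finally show ?thesis .
qed

section \<open>Weighted walks and matrices of cyclic form\<close>

text \<open>These are the entries of the \<open>k\<close>-th power, for matrices given as functions
  on any index set, so that numbers and index pairs can be treated alike.\<close>

primrec walk :: "'i set \<Rightarrow> ('i \<Rightarrow> 'i \<Rightarrow> 'a::comm_semiring_1) \<Rightarrow> nat \<Rightarrow> 'i \<Rightarrow> 'i \<Rightarrow> 'a" where
  "walk I A 0 u v = (if u = v then 1 else 0)"
| "walk I A (Suc k) u v = (\<Sum>x\<in>I. walk I A k u x * A x v)"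

lemma walk_add:
  assumes "finite I" "v \<in> I"
  shows "walk I A (j + k) u v = (\<Sum>x\<in>I. walk I A j u x * walk I A k x v)"
  using assms(2)
proof (induction k arbitrary: v)
  case 0
  then show ?case using assms(1) by (simp add: if_distrib cong: if_cong)
next
  case (Suc k)
  have "walk I A (j + Suc k) u v = (\<Sum>x\<in>I. \<Sum>y\<in>I. walk I A j u y * walk I A k y x * A x v)"
    by (simp add: Suc.IH sum_distrib_right)
  also have "\<dots> = (\<Sum>y\<in>I. walk I A j u y * walk I A (Suc k) y v)"
    by (subst sum.swap) (simp add: sum_distrib_left mult.assoc)
  finally show ?case .
qed

lemma walk_1: "finite I \<Longrightarrow> u \<in> I \<Longrightarrow> walk I A (Suc 0) u v = A u v"
  by (simp add: if_distrib[of "\<lambda>x. x * _"] cong: if_cong)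

lemma walk_Suc_left:
  assumes "finite I" "u \<in> I" "v \<in> I"
  shows "walk I A (Suc k) u v = (\<Sum>x\<in>I. A u x * walk I A k x v)"
  using walk_add[OF assms(1,3), of A 1 k u] walk_1[OF assms(1,2), of A] by simp

lemma walk_mat:
  assumes M: "M \<in> carrier_mat n n"
  shows "i < n \<Longrightarrow> j < n \<Longrightarrow> (M ^\<^sub>m k) $$ (i, j) = walk {..<n} (\<lambda>r s. M $$ (r, s)) k i j"
proof (induction k arbitrary: j)
  case 0
  then show ?case using M by auto
next
  case (Suc k)
  then have "(M ^\<^sub>m Suc k) $$ (i, j) = (\<Sum>l<n. (M ^\<^sub>m k) $$ (i, l) * M $$ (l, j))"
    using M by (auto simp: scalar_prod_def lessThan_atLeast0)
  then show ?case using Suc by simp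
qed

lemma walk_bij:
  assumes "bij_betw \<phi> I J" "\<And>r s. r \<in> I \<Longrightarrow> s \<in> I \<Longrightarrow> A r s = B (\<phi> r) (\<phi> s)"
  shows "r \<in> I \<Longrightarrow> s \<in> I \<Longrightarrow> walk I A k r s = walk J B k (\<phi> r) (\<phi> s)"
proof (induction k arbitrary: s)
  case 0
  then show ?case using assms(1) by (auto simp: bij_betw_def inj_on_def)
next
  case (Suc k)
  have "walk I A (Suc k) r s = (\<Sum>x\<in>I. walk J B k (\<phi> r) (\<phi> x) * B (\<phi> x) (\<phi> s))"
    using Suc assms(2) by simp
  also have "\<dots> = walk J B (Suc k) (\<phi> r) (\<phi> s)"
    using sum.reindex_bij_betw[OF assms(1), of "\<lambda>x. walk J B k (\<phi> r) x * B x (\<phi> s)"] by simp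
  finally show ?case .
qed

lemma bij_betw_residues:
  assumes "q > 0"
  shows "bij_betw (\<lambda>j. (i + int j) mod int q) {s..<s + q} {0..<int q}"
proof -
  have inj: "inj_on (\<lambda>j. (i + int j) mod int q) {s..<s + q}"
  proof (rule inj_onI)
    fix x y assume xy: "x \<in> {s..<s + q}" "y \<in> {s..<s + q}"
      and "(i + int x) mod int q = (i + int y) mod int q"
    then have "int q dvd (i + int x) - (i + int y)" by (simp only: mod_eq_dvd_iff)
    then have "int q dvd int x - int y" by simp
    moreover have "\<bar>int x - int y\<bar> < int q" using xy by auto
    ultimately have "int x - int y = 0"
      using zdvd_not_zless[of "\<bar>int x - int y\<bar>" "int q"] by (metis dvd_abs_iff zero_less_abs_iff)
    then show "x = y" by simp
  qed
  moreover have "(\<lambda>j. (i + int j) mod int q) ` {s..<s + q} = {0..<int q}"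
  proof (rule card_subset_eq)
    show "card ((\<lambda>j. (i + int j) mod int q) ` {s..<s + q}) = card {0..<int q}"
      using card_image[OF inj] by simp
  qed (use assms in auto)
  ultimately show ?thesis by (simp add: bij_betw_def)
qed

text \<open>This is the part of \<open>cyclic_mat\<close> that stays within the levels:
  \<open>d\<close> disjoint \<open>q\<close>-cycles.\<close>

definition loop_mat :: "nat \<Rightarrow> (nat \<Rightarrow> int \<Rightarrow> real) \<Rightarrow> nat \<times> int \<Rightarrow> nat \<times> int \<Rightarrow> real" where
  "loop_mat q b = (\<lambda>(t, i) (t', i'). if t' = t \<and> i' = (i + 1) mod int q then b t i else 0)"

text \<open>Each index has a single outgoing edge, so only one walk of each length starts
  there.\<close>

lemma walk_loop_mat:
  assumes "t < d" "i \<in> {0..<int q}"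
  shows "walk ({..<d} \<times> {0..<int q}) (loop_mat q b) k (t, i) (t', i') =
    (if t' = t \<and> i' = (i + int k) mod int q then \<Prod>j<k. b t ((i + int j) mod int q) else 0)"
proof (induction k arbitrary: t' i')
  case 0
  then show ?case using assms by auto
next
  case (Suc k)
  let ?I = "{..<d} \<times> {0..<int q}"
  let ?x = "(t, (i + int k) mod int q)"
  let ?P = "\<lambda>k. \<Prod>j<k. b t ((i + int j) mod int q)"
  have x: "?x \<in> ?I" using assms by auto
  have eq: "((i + int k) mod int q + 1) mod int q = (i + int (Suc k)) mod int q"
    unfolding mod_add_left_eq by (simp add: algebra_simps)
  have "walk ?I (loop_mat q b) (Suc k) (t, i) (t', i') =
      (\<Sum>x\<in>?I. if x = ?x then ?P k * loop_mat q b ?x (t', i') else 0)"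
    unfolding walk.simps
    by (intro sum.cong refl) (use Suc.IH in \<open>force split: prod.split\<close>)
  also have "\<dots> = ?P k * loop_mat q b ?x (t', i')" using x by simp
  also have "\<dots> = (if t' = t \<and> i' = (i + int (Suc k)) mod int q then ?P (Suc k) else 0)"
    using eq by (auto simp: loop_mat_def)
  finally show ?case .
qed

text \<open>Each of the \<open>m\<close> blocks of \<open>q\<close> consecutive factors runs once
  through all residues.\<close>

lemma prod_loop:
  fixes b :: "int \<Rightarrow> 'a::comm_monoid_mult"
  assumes "q > 0" "(\<Prod>i\<in>{0..<int q}. b i) = \<beta>"
  shows "(\<Prod>j<m * q. b ((i + int j) mod int q)) = \<beta> ^ m"
proof -
  have "(\<Prod>j\<in>{l * q..<l * q + q}. b ((i + int j) mod int q)) = \<beta>" for l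
    using prod.reindex_bij_betw[OF bij_betw_residues[OF assms(1), of i "l * q"], of b] assms(2) by simp
  then show ?thesis by (simp flip: prod.nat_group)
qed

section \<open>From the interval form to the traces\<close>

locale interval_matrix =
  fixes q d z c :: nat and \<beta> :: real and S :: "nat \<Rightarrow> int set" and b :: "nat \<Rightarrow> int \<Rightarrow> real"
    and a :: "nat \<Rightarrow> nat" and \<rho> :: int
  assumes q: "q \<ge> 2" and d: "d \<ge> 2" and z: "1 \<le> z" "z \<le> q - 1" and c: "c = d + z"
    and data: "interval_data q d z S a \<rho>" and weights: "weight_condition q d \<beta> S b"
begin

text \<open>The unreduced left end of the interval of level \<open>t\<close>; \<open>cutp t\<close>
  is one past the right end. Counted from \<open>cutp t\<close>, the exits are the last positions
  before a full turn.\<close>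

definition "base t = \<rho> - (\<Sum>j=1..t. int (a j + 1))"
definition "cutp t = base t + int (a t) + 1"
definition "I = {..<d} \<times> {0..<int q}"
abbreviation "A \<equiv> cyclic_mat q d c S b"
abbreviation "B \<equiv> loop_mat q b"

text \<open>The position of \<open>(t, i)\<close> on a closed walk through all levels, cut just before the entries
  into level \<open>t\<close>. An edge raises it by \<open>1\<close> except for losses of \<open>q\<close> at the cuts and of
  \<open>q * d - z\<close> on returning to level \<open>0\<close>, so the length of a closed walk is
  a sum of such losses.\<close>

definition pos :: "nat \<times> int \<Rightarrow> int" where
  "pos = (\<lambda>(t, i). (i - cutp t) mod int q + (\<Sum>j<t. int q - int (a j)))"

text \<open>The \<open>a t\<close> have sum \<open>z\<close> and \<open>c = d + z\<close>, so the
  entries into level 0 also begin at its cut, as \<open>cutp_Suc\<close> gives for the other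
  levels.\<close>

lemma cutp_0: "cutp 0 = base (d - 1) + int c"
proof -
  have "{..<d} = insert 0 {1..d - 1}" using d by auto
  then have "(\<Sum>j<d. int (a j + 1)) = int (a 0 + 1) + (\<Sum>j=1..d - 1. int (a j + 1))" by simp
  moreover have "(\<Sum>j<d. int (a j + 1)) = int d + int z"
    using data by (auto simp: interval_data_def sum.distrib simp flip: of_nat_sum)
  ultimately show ?thesis by (simp add: cutp_def base_def c)
qed

lemma cutp_Suc: "cutp (Suc t) = base t"
  by (simp add: cutp_def base_def)

lemma a_le: "t < d \<Longrightarrow> a t \<le> q - 1"
  using member_le_sum[of t "{..<d}" a] data z by (auto simp: interval_data_def)

text \<open>Since \<open>a t < q\<close>, the interval does not run past the cut, so the remainder
  can be evaluated explicitly.\<close>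

lemma exit_pos:
  assumes "t < d" "i \<in> S t"
  obtains x where "0 \<le> x" "x < int q" "i = (base t + x) mod int q"
    "(i - cutp t) mod int q = int q - 1 - int (a t) + x"
proof -
  have "S t \<subseteq> cyclic_interval q (base t) (a t + 1)"
  proof (cases "t = 0")
    case True
    then show ?thesis using data by (simp add: interval_data_def base_def)
  next
    case False
    then have "t \<in> {1..<d}" using assms(1) by simp
    then show ?thesis using data unfolding interval_data_def base_def by blast
  qed
  then obtain k where k: "k < a t + 1" "i = (base t + int k) mod int q"
    using assms(2) by (auto simp: cyclic_interval_def)
  note al = a_le[OF assms(1)]
  have "(i - cutp t) mod int q = (int k - int (a t) - 1) mod int q"
    unfolding k(2) mod_diff_left_eq by (simp add: cutp_def algebra_simps)
  also have "\<dots> = (int k - int (a t) - 1 + int q) mod int q" by simp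
  also have "\<dots> = int k - int (a t) - 1 + int q"
    using k al q by (intro mod_pos_pos_trivial) auto
  finally show ?thesis using that[of "int k"] k al q by auto
qed

text \<open>\<open>e\<close> counts crossings of a cut and \<open>w\<close> returns to level 0. With
  \<open>d\<close> added for every return the level never drops, and it rises on an edge between
  levels; a closed walk with such an edge thus has \<open>w \<ge> 1\<close>.\<close>

lemma edge:
  assumes "x \<in> I" "y \<in> I" "A x y \<noteq> 0"
  shows "\<exists>e w :: nat. pos y + int q * int e + int (q * d - z) * int w = pos x + 1
    \<and> fst x \<le> fst y + d * w \<and> (A x y \<noteq> B x y \<longrightarrow> fst x < fst y + d * w)"
proof -
  obtain t i t' i' where xy: "x = (t, i)" "y = (t', i')" by fastforce
  have t: "t < d" "t' < d" using assms by (auto simp: I_def xy)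
  consider (loop) "t' = t" "i' = (i + 1) mod int q"
    | (up) "t < d - 1" "i \<in> S t" "t' = t + 1" "i' = i"
    | (last) "t = d - 1" "i \<in> S t" "t' = 0" "i' = (i + int c) mod int q"
    using assms(3) unfolding xy cyclic_mat_def by (auto split: if_splits)
  then show ?thesis
  proof cases
    case loop
    define r where "r = (i - cutp t) mod int q"
    have r: "0 \<le> r" "r < int q" using q by (auto simp: r_def)
    have "(i' - cutp t) mod int q = (r + 1) mod int q"
      unfolding loop r_def mod_diff_left_eq mod_add_left_eq by (simp add: algebra_simps)
    also have "\<dots> = r + 1 \<or> \<dots> = r + 1 - int q"
      using r by (cases "r = int q - 1") auto
    finally have "pos y = pos x + 1 \<or> pos y + int q = pos x + 1"
      unfolding xy pos_def loop(1) by (auto simp: r_def)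
    moreover have "A x y = B x y" unfolding xy cyclic_mat_def loop_mat_def using loop by simp
    ultimately show ?thesis
    proof (elim disjE)
      assume "pos y = pos x + 1" "A x y = B x y"
      then show ?thesis using loop by (intro exI[of _ 0]) (auto simp: xy)
    next
      assume "pos y + int q = pos x + 1" "A x y = B x y"
      then show ?thesis using loop by (intro exI[of _ 1] exI[of _ 0]) (auto simp: xy)
    qed
  next
    case up
    obtain k where k: "0 \<le> k" "k < int q" "i = (base t + k) mod int q"
      "(i - cutp t) mod int q = int q - 1 - int (a t) + k" using exit_pos[OF t(1) up(2)] .
    have "(i - base t) mod int q = k" unfolding k(3) mod_diff_left_eq using k(1,2) by simp
    then have "pos y = pos x + 1" by (simp add: pos_def xy up k(4) cutp_Suc)
    then show ?thesis using up by (intro exI[of _ 0]) (auto simp: xy)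
  next
    case last
    obtain k where k: "0 \<le> k" "k < int q" "i = (base t + k) mod int q"
      "(i - cutp t) mod int q = int q - 1 - int (a t) + k" using exit_pos[OF t(1) last(2)] .
    have "(i' - cutp 0) mod int q = k" unfolding last(4) k(3) cutp_0 last(1) mod_add_left_eq mod_diff_left_eq
      using k(1,2) by (simp add: algebra_simps)
    then have y: "pos y = k" by (simp add: pos_def xy last)
    have zn: "z \<le> q * d" using z d by (metis diff_le_self le_trans mult_le_mono2 nat_mult_1_right one_le_numeral)
    \<comment> \<open>Over all levels the terms \<open>q - a j\<close> add up to
      \<open>q * d - z\<close>, which is the loss on returning to level 0.\<close>
    have "(\<Sum>j<Suc (d - 1). int q - int (a j)) = int q * int d - int z"
      using data d by (auto simp: interval_data_def sum_subtractf simp flip: of_nat_sum)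
    then have "pos x + 1 = k + int (q * d - z)"
      using zn k(4) last(1) by (simp add: xy pos_def of_nat_diff)
    then show ?thesis using y last d by (intro exI[of _ 0] exI[of _ 1]) (auto simp: xy)
  qed
qed

lemma walk_pos:
  assumes "x \<in> I"
  shows "y \<in> I \<Longrightarrow> walk I A k x y \<noteq> 0 \<Longrightarrow>
    \<exists>e w :: nat. pos y + int q * int e + int (q * d - z) * int w = pos x + int k
      \<and> fst x \<le> fst y + d * w"
proof (induction k arbitrary: y)
  case 0
  then show ?case by (intro exI[of _ 0]) (auto split: if_splits)
next
  case (Suc k)
  then obtain v where v: "v \<in> I" "walk I A k x v * A v y \<noteq> 0"
    unfolding walk.simps by (meson sum.not_neutral_contains_not_neutral)
  from Suc.IH[OF v(1)] v(2) obtain e w :: nat where 1: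
    "pos v + int q * int e + int (q * d - z) * int w = pos x + int k" "fst x \<le> fst v + d * w" by auto
  from edge[OF v(1) Suc.prems(1)] v(2) obtain e' w' :: nat where 2:
    "pos y + int q * int e' + int (q * d - z) * int w' = pos v + 1" "fst v \<le> fst y + d * w'" by auto
  show ?case
    using 1 2 by (intro exI[of _ "e + e'"] exI[of _ "w + w'"]) (auto simp: algebra_simps)
qed

lemma B_imp_A: "B x y \<noteq> 0 \<Longrightarrow> A x y = B x y"
  by (cases x; cases y) (auto simp: cyclic_mat_def loop_mat_def split: if_splits)

text \<open>Different weights require a walk with an edge outside \<open>B\<close>, which makes the
  level inequality strict. The induction distinguishes whether the difference arises at the last
  edge or before it.\<close>

lemma walk_exit:
  assumes "x \<in> I"
  shows "y \<in> I \<Longrightarrow> walk I A k x y \<noteq> walk I B k x y \<Longrightarrow>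
    \<exists>e w :: nat. pos y + int q * int e + int (q * d - z) * int w = pos x + int k
      \<and> fst x < fst y + d * w"
proof (induction k arbitrary: y)
  case 0
  then show ?case by simp
next
  case (Suc k)
  then have "\<not> (\<forall>v\<in>I. walk I A k x v * A v y = walk I B k x v * B v y)"
    unfolding walk.simps by (meson sum.cong)
  then obtain v where v: "v \<in> I" "walk I A k x v * A v y \<noteq> walk I B k x v * B v y" by blast
  show ?case
  proof (cases "walk I A k x v = walk I B k x v")
    case True
    then have ne: "A v y \<noteq> B v y" "walk I A k x v \<noteq> 0" using v(2) by auto
    then have "A v y \<noteq> 0" using B_imp_A[of v y] by force
    from walk_pos[OF assms v(1) ne(2)] obtain e w :: nat where 1:
      "pos v + int q * int e + int (q * d - z) * int w = pos x + int k" "fst x \<le> fst v + d * w" by auto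
    from edge[OF v(1) Suc.prems(1) \<open>A v y \<noteq> 0\<close>] ne(1) obtain e' w' :: nat where 2:
      "pos y + int q * int e' + int (q * d - z) * int w' = pos v + 1" "fst v < fst y + d * w'" by auto
    show ?thesis
      using 1 2 by (intro exI[of _ "e + e'"] exI[of _ "w + w'"]) (auto simp: algebra_simps)
  next
    case False
    have "A v y \<noteq> 0" using v(2) B_imp_A[of v y] by force
    from Suc.IH[OF v(1) False] obtain e w :: nat where 1:
      "pos v + int q * int e + int (q * d - z) * int w = pos x + int k" "fst x < fst v + d * w" by auto
    from edge[OF v(1) Suc.prems(1) \<open>A v y \<noteq> 0\<close>] obtain e' w' :: nat where 2:
      "pos y + int q * int e' + int (q * d - z) * int w' = pos v + 1" "fst v \<le> fst y + d * w'" by auto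
    show ?thesis
      using 1 2 by (intro exI[of _ "e + e'"] exI[of _ "w + w'"]) (auto simp: algebra_simps)
  qed
qed

text \<open>A closed walk with an edge between levels has length \<open>q e + (q d - z) w\<close>
  with \<open>w \<ge> 1\<close>; up to \<open>q * d\<close> this leaves only \<open>e = 0\<close>,
  \<open>w = 1\<close>. At every other length the weight is that of the loops in
  \<open>B\<close>.\<close>

lemma closed_walk:
  assumes "x \<in> I" "k \<le> q * d" "k \<noteq> q * d - z"
  shows "walk I A k x x = (if q dvd k then \<beta> ^ (k div q) else 0)"
proof -
  obtain t i where x: "x = (t, i)" "t < d" "i \<in> {0..<int q}" using assms(1) by (auto simp: I_def)
  have "2 * q \<le> q * d" using d by simp
  then have n: "z < q * d" "2 * (q * d - z) > q * d" using z q by linarith+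
  have "walk I A k x x = walk I B k x x"
  proof (rule ccontr)
    assume "walk I A k x x \<noteq> walk I B k x x"
    from walk_exit[OF assms(1) assms(1) this] obtain e w :: nat where
      "int q * int e + int (q * d - z) * int w = int k" "w \<noteq> 0" by fastforce
    then have k: "q * e + (q * d - z) * w = k" by (metis of_nat_add of_nat_eq_iff of_nat_mult)
    have "e = 0"
    proof (rule ccontr)
      assume "e \<noteq> 0"
      then have "q \<le> q * e" "q * d - z \<le> (q * d - z) * w" using \<open>w \<noteq> 0\<close> by simp_all
      then show False using k assms(2) z q n by linarith
    qed
    moreover have "w = 1"
    proof (rule ccontr)
      assume "w \<noteq> 1"
      then have "(q * d - z) * 2 \<le> (q * d - z) * w" using \<open>w \<noteq> 0\<close> by (intro mult_le_mono2) simp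
      then show False using k assms(2) n by linarith
    qed
    ultimately show False using k assms(3) by simp
  qed
  also have "\<dots> = (if i = (i + int k) mod int q then \<Prod>j<k. b t ((i + int j) mod int q) else 0)"
    unfolding x(1) I_def by (subst walk_loop_mat[OF x(2,3)]) simp
  also have "i = (i + int k) mod int q \<longleftrightarrow> q dvd k"
  proof -
    have "i = i mod int q" using x(3) by simp
    then have "i = (i + int k) mod int q \<longleftrightarrow> (i + int k) mod int q = i mod int q" by metis
    also have "\<dots> \<longleftrightarrow> q dvd k" by (simp add: mod_eq_dvd_iff)
    finally show ?thesis .
  qed
  also have "(if q dvd k then \<Prod>j<k. b t ((i + int j) mod int q) else 0) =
      (if q dvd k then \<beta> ^ (k div q) else 0)"
  proof (cases "q dvd k")
    case True
    have "S t \<subseteq> {0..<int q}"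
    proof
      fix j assume "j \<in> S t"
      then obtain y where "j = (base t + y) mod int q" using exit_pos[OF x(2)] by metis
      then show "j \<in> {0..<int q}" using q by simp
    qed
    then have "(\<Prod>j\<in>{0..<int q}. b t j) = (\<Prod>j\<in>S t. b t j)"
      using weights x(2) by (intro prod.mono_neutral_right) (auto simp: weight_condition_def)
    also have "\<dots> = \<beta>" using weights x(2) by (simp add: weight_condition_def)
    finally have "(\<Prod>j<(k div q) * q. b t ((i + int j) mod int q)) = \<beta> ^ (k div q)"
      using q by (intro prod_loop) auto
    then show ?thesis using True by simp
  qed simp
  finally show ?thesis .
qed

end

section \<open>Matrices with the prescribed traces\<close>

locale rigid_matrix =
  fixes I :: "'i set" and A :: "'i \<Rightarrow> 'i \<Rightarrow> real" and q d z :: nat and \<beta> w :: real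
  assumes finI: "finite I" and cardI: "card I = q * d"
    and nonneg: "\<And>x y. x \<in> I \<Longrightarrow> y \<in> I \<Longrightarrow> 0 \<le> A x y"
    and rows: "\<And>x. x \<in> I \<Longrightarrow> (\<Sum>y\<in>I. A x y) = 1"
    and q: "q \<ge> 2" and d: "d \<ge> 2" and z: "1 \<le> z" "z \<le> q - 1"
    and \<beta>: "0 < \<beta>" "\<beta> < 1"
    and trace: "\<And>k. 1 \<le> k \<Longrightarrow> k \<le> q * d \<Longrightarrow> (\<Sum>x\<in>I. walk I A k x x) =
      (if q dvd k then real (q * d) * \<beta> ^ (k div q) else 0)
      + (if k = q * d - z then real (q * d - z) * w else 0)"
begin

abbreviation "W \<equiv> walk I A"

text \<open>The last bound is what later excludes closed walks through fewer than \<open>d\<close>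
  cycles.\<close>

lemma qd: "2 * q \<le> q * d" "z < q * d" "q < q * d - z" "(d - 1) * q < q * d - z"
proof -
  show 1: "2 * q \<le> q * d" using d by simp
  show "z < q * d" "q < q * d - z" using 1 z q by linarith+
  have "(d - 1) * q = q * d - q" by (cases d) (simp_all add: mult.commute)
  then show "(d - 1) * q < q * d - z" using 1 z q by linarith
qed

lemma not_dvd: "\<not> q dvd q * d - z"
proof
  assume "q dvd q * d - z"
  then have "q dvd q * d - (q * d - z)" by (rule dvd_diff_nat[OF dvd_triv_left])
  moreover have "q * d - (q * d - z) = z" using qd by simp
  ultimately show False using z q by (auto dest: dvd_imp_le)
qed

lemma W_nonneg: "x \<in> I \<Longrightarrow> y \<in> I \<Longrightarrow> 0 \<le> W k x y"
  by (induction k arbitrary: y) (auto intro!: sum_nonneg mult_nonneg_nonneg nonneg)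

lemma W_add_ge:
  assumes "x \<in> I" "y \<in> I" "v \<in> I"
  shows "W j x y * W k y v \<le> W (j + k) x v"
  unfolding walk_add[OF finI assms(3)]
  using assms by (intro member_le_sum[of y I "\<lambda>y. W j x y * W k y v"] mult_nonneg_nonneg W_nonneg finI) auto

lemma W_add_pos:
  assumes "x \<in> I" "y \<in> I" "v \<in> I" "W j x y > 0" "W k y v > 0"
  shows "W (j + k) x v > 0"
  using W_add_ge[OF assms(1-3), of j k] mult_pos_pos[OF assms(4,5)] by linarith

lemma W_1: "x \<in> I \<Longrightarrow> W (Suc 0) x y = A x y"
  by (rule walk_1[OF finI])

lemma W_edge_pos:
  assumes "x \<in> I" "y \<in> I" "v \<in> I" "A x y > 0" "W k y v > 0"
  shows "W (Suc k) x v > 0"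
  using W_add_pos[OF assms(1-3), of 1 k] assms W_1[of x y] by simp

lemma no_closed_walk:
  assumes "x \<in> I" "1 \<le> k" "k \<le> q * d" "\<not> q dvd k" "k \<noteq> q * d - z"
  shows "W k x x = 0"
proof -
  have "(\<Sum>x\<in>I. W k x x) = 0" using trace[OF assms(2,3)] assms by simp
  then show ?thesis using sum_nonneg_eq_0_iff[OF finI, of "\<lambda>x. W k x x"] W_nonneg assms(1) by blast
qed

lemma trace_mult:
  assumes "1 \<le> m" "m \<le> d"
  shows "(\<Sum>x\<in>I. W (m * q) x x) = real (q * d) * \<beta> ^ m"
proof -
  have "m * q \<noteq> q * d - z" using not_dvd by (metis dvd_triv_right)
  moreover have "1 \<le> m * q" "m * q \<le> q * d" using assms q by (simp_all add: mult.commute)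
  ultimately show ?thesis using trace[of "m * q"] q by simp
qed

lemma sum_eq_imp_eq:
  fixes f :: "'i \<Rightarrow> real"
  assumes "\<And>x. x \<in> I \<Longrightarrow> r \<le> f x" "(\<Sum>x\<in>I. f x) = real (q * d) * r" "x \<in> I"
  shows "f x = r"
proof -
  have "(\<Sum>x\<in>I. f x - r) = 0" using assms(2) cardI by (simp add: sum_subtractf)
  then have "\<forall>x\<in>I. f x - r = 0"
    using sum_nonneg_eq_0_iff[OF finI, of "\<lambda>x. f x - r"] assms(1) by simp
  then show ?thesis using assms(3) by simp
qed

text \<open>Equality in the Cauchy--Schwarz inequality for the diagonal of the \<open>q\<close>-th power.\<close>

lemma W_q: "x \<in> I \<Longrightarrow> W q x x = \<beta>"
  and W_2q: "x \<in> I \<Longrightarrow> W (2 * q) x x = \<beta>\<^sup>2"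
proof -
  have sq: "(W q x x)\<^sup>2 \<le> W (2 * q) x x" if "x \<in> I" for x
    using W_add_ge[OF that that that, of q q] by (simp add: power2_eq_square mult_2)
  have t: "(\<Sum>x\<in>I. W q x x) = real (q * d) * \<beta>" "(\<Sum>x\<in>I. W (2 * q) x x) = real (q * d) * \<beta>\<^sup>2"
    using trace_mult[of 1] trace_mult[of 2] d by simp_all
  \<comment> \<open>The deviations of the diagonal from \<open>\<beta>\<close> have square sum at
    most 0, because going round twice bounds each square by a diagonal entry of the
    \<open>2q\<close>-th power.\<close>
  have "(\<Sum>x\<in>I. (W q x x - \<beta>)\<^sup>2) = (\<Sum>x\<in>I. (W q x x)\<^sup>2) - 2 * \<beta> * (\<Sum>x\<in>I. W q x x) + real (q * d) * \<beta>\<^sup>2"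
    using cardI by (simp add: power2_diff sum.distrib sum_subtractf sum_distrib_left algebra_simps)
  also have "\<dots> \<le> (\<Sum>x\<in>I. W (2 * q) x x) - 2 * \<beta> * (\<Sum>x\<in>I. W q x x) + real (q * d) * \<beta>\<^sup>2"
    using sum_mono[of I "\<lambda>x. (W q x x)\<^sup>2" "\<lambda>x. W (2 * q) x x"] sq by simp
  also have "\<dots> = 0" unfolding t by (simp add: power2_eq_square)
  finally have "(\<Sum>x\<in>I. (W q x x - \<beta>)\<^sup>2) = 0"
    using sum_nonneg[of I "\<lambda>x. (W q x x - \<beta>)\<^sup>2"] by simp
  then have eq: "\<forall>x\<in>I. (W q x x - \<beta>)\<^sup>2 = 0"
    by (subst (asm) sum_nonneg_eq_0_iff[OF finI]) auto
  then show 1: "W q x x = \<beta>" if "x \<in> I" for x using that by simp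
  show "W (2 * q) x x = \<beta>\<^sup>2" if "x \<in> I" for x
    using sum_eq_imp_eq[of "\<beta>\<^sup>2" "\<lambda>x. W (2 * q) x x"] sq 1 t(2) that by metis
qed

text \<open>Split a closed walk of length \<open>2 * q\<close> at its middle point. The middle point
  \<open>x\<close> alone already yields the full weight \<open>\<beta>\<^sup>2\<close>, so no other
  one is possible.\<close>

lemma W_q_antisym:
  assumes "x \<in> I" "y \<in> I" "W q x y > 0" "W q y x > 0"
  shows "x = y"
proof (rule ccontr)
  assume ne: "x \<noteq> y"
  have "(\<Sum>v\<in>{x, y}. W q x v * W q v x) \<le> (\<Sum>v\<in>I. W q x v * W q v x)"
    using assms W_nonneg by (intro sum_mono2 finI) auto
  also have "\<dots> = \<beta>\<^sup>2"
    using W_2q[OF assms(1)] walk_add[OF finI assms(1), of A q q x] by (simp add: mult_2)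
  finally show False
    using ne mult_pos_pos[OF assms(3,4)] by (simp add: W_q assms power2_eq_square)
qed

text \<open>The next index on a closed walk of length \<open>q\<close>; by
  \<open>succ_unique\<close> the choice is forced.\<close>

definition succ :: "'i \<Rightarrow> 'i" where
  "succ x = (SOME y. y \<in> I \<and> A x y > 0 \<and> W (q - 1) y x > 0)"

lemma succ:
  assumes "x \<in> I"
  shows succ_in: "succ x \<in> I" and succ_edge: "A x (succ x) > 0" and succ_back: "W (q - 1) (succ x) x > 0"
proof -
  have "W q x x = (\<Sum>y\<in>I. A x y * W (q - 1) y x)"
    using walk_Suc_left[OF finI assms assms, of A "q - 1"] q by simp
  then have "(\<Sum>y\<in>I. A x y * W (q - 1) y x) \<noteq> 0" using W_q[OF assms] \<beta> by simp
  then obtain y where y: "y \<in> I" "A x y * W (q - 1) y x \<noteq> 0"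
    by (meson sum.not_neutral_contains_not_neutral)
  then have "A x y > 0" "W (q - 1) y x > 0"
    using nonneg[OF assms y(1)] W_nonneg[OF y(1) assms, of "q - 1"] by force+
  then have "\<exists>y. y \<in> I \<and> A x y > 0 \<and> W (q - 1) y x > 0" using y by blast
  from someI_ex[OF this] show "succ x \<in> I" "A x (succ x) > 0" "W (q - 1) (succ x) x > 0"
    by (auto simp: succ_def)
qed

text \<open>From either candidate one returns to \<open>x\<close> in \<open>q - 1\<close> steps and
  goes on to the other in one, so \<open>W_q_antisym\<close> identifies them.\<close>

lemma succ_unique:
  assumes "x \<in> I" "y \<in> I" "A x y > 0" "W (q - 1) y x > 0"
  shows "y = succ x"
proof (rule W_q_antisym)
  have q1: "(q - 1) + 1 = q" using q by simp
  show "W q y (succ x) > 0"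
    using W_add_pos[OF assms(2,1) succ_in, of x "q - 1" 1] assms succ_edge[OF assms(1)] W_1 q1 by simp
  show "W q (succ x) y > 0"
    using W_add_pos[OF succ_in assms(1,2), of x "q - 1" 1] assms succ_back[OF assms(1)] W_1 q1 by simp
qed (use assms succ_in in auto)

lemma it_in: "x \<in> I \<Longrightarrow> (succ ^^ j) x \<in> I"
  by (induction j) (auto simp: succ_in)

lemma it_walk: "x \<in> I \<Longrightarrow> W j x ((succ ^^ j) x) > 0"
proof (induction j)
  case (Suc j)
  then show ?case
    using W_add_pos[of x "(succ ^^ j) x" "(succ ^^ Suc j) x" j 1] it_in[of x] succ_edge[of "(succ ^^ j) x"] W_1
      it_in[of x "Suc j"] by simp
qed simp

text \<open>A closed walk of length \<open>q\<close> is forced to follow \<open>succ\<close> step by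
  step, so its weight splits into the first \<open>j\<close> edges and the remaining walk.\<close>

lemma it_back:
  assumes "x \<in> I"
  shows "j \<le> q \<Longrightarrow> W (q - j) ((succ ^^ j) x) x > 0 \<and>
    W q x x = (\<Prod>i<j. A ((succ ^^ i) x) (succ ((succ ^^ i) x))) * W (q - j) ((succ ^^ j) x) x"
proof (induction j)
  case 0
  then show ?case using W_q[OF assms] \<beta> by simp
next
  case (Suc j)
  let ?y = "(succ ^^ j) x"
  have y: "?y \<in> I" by (rule it_in[OF assms])
  have IH: "W (q - j) ?y x > 0"
    "W q x x = (\<Prod>i<j. A ((succ ^^ i) x) (succ ((succ ^^ i) x))) * W (q - j) ?y x"
    using Suc by simp_all
  have zero: "A ?y v * W (q - Suc j) v x = 0" if v: "v \<in> I" "v \<noteq> succ ?y" for v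
  proof (rule ccontr)
    assume "A ?y v * W (q - Suc j) v x \<noteq> 0"
    then have pos: "A ?y v > 0" "W (q - Suc j) v x > 0"
      using nonneg[OF y v(1)] W_nonneg[OF v(1) assms, of "q - Suc j"] by force+
    \<comment> \<open>Going from \<open>v\<close> to \<open>x\<close> and then along
      \<open>succ\<close> to \<open>?y\<close> takes \<open>q - 1\<close> steps, which makes
      \<open>v\<close> the successor of \<open>?y\<close>.\<close>
    have "q - Suc j + j = q - 1" using Suc.prems by simp
    then have "W (q - 1) v ?y > 0"
      using W_add_pos[OF v(1) assms y pos(2) it_walk[OF assms]] by simp
    then show False using succ_unique[OF y v(1) pos(1)] v(2) by simp
  qed
  have "W (q - j) ?y x = (\<Sum>v\<in>I. A ?y v * W (q - Suc j) v x)"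
    using walk_Suc_left[OF finI y assms, of A "q - Suc j"] Suc.prems by (simp add: Suc_diff_Suc)
  also have "\<dots> = (\<Sum>v\<in>{succ ?y}. A ?y v * W (q - Suc j) v x)"
    using zero succ_in[OF y] by (intro sum.mono_neutral_right finI) auto
  finally have eq: "W (q - j) ?y x = A ?y (succ ?y) * W (q - Suc j) (succ ?y) x" by simp
  have "W (q - Suc j) (succ ?y) x > 0"
    using IH(1) eq W_nonneg[OF succ_in[OF y] assms, of "q - Suc j"]
    by (metis less_eq_real_def less_irrefl mult_zero_right)
  then show ?case using IH(2) eq by simp
qed

text \<open>After \<open>q\<close> steps a walk of length 0 remains, and its weight is positive only
  if its ends agree.\<close>

lemma it_period: "x \<in> I \<Longrightarrow> (succ ^^ q) x = x"
  using it_back[of x q] by (auto split: if_splits)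

lemma prod_orbit: "x \<in> I \<Longrightarrow> (\<Prod>i<q. A ((succ ^^ i) x) (succ ((succ ^^ i) x))) = \<beta>"
  using it_back[of x q] it_period[of x] W_q[of x] by simp

lemma it_neq:
  assumes "x \<in> I" "0 < j" "j < q"
  shows "(succ ^^ j) x \<noteq> x"
proof
  assume "(succ ^^ j) x = x"
  then have "W j x x > 0" using it_walk[OF assms(1), of j] by simp
  moreover have "W j x x = 0"
    using assms qd by (intro no_closed_walk) (auto dest: dvd_imp_le)
  ultimately show False by simp
qed

text \<open>Repeating the loop of length \<open>q\<close> gives the lower bound
  \<open>\<beta> ^ m\<close>, and by the trace this bound is the average.\<close>

lemma W_mult: 
  assumes "x \<in> I" "m \<le> d"
  shows "W (m * q) x x = \<beta> ^ m"
proof (cases "m = 0")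
  case False
  have ge: "\<beta> ^ m \<le> W (m * q) y y" if "y \<in> I" for y m
  proof (induction m)
    case (Suc m)
    have "\<beta> ^ Suc m \<le> W q y y * W (m * q) y y"
      using Suc W_q[OF that] \<beta> by (simp add: mult_left_mono)
    also have "\<dots> \<le> W (Suc m * q) y y" using W_add_ge[OF that that that, of q "m * q"] by simp
    finally show ?case .
  qed simp
  show ?thesis
    using sum_eq_imp_eq[of "\<beta> ^ m" "\<lambda>x. W (m * q) x x"] ge trace_mult[of m] False assms by simp
qed simp

text \<open>The loops along \<open>succ\<close> already account for all closed walks of length \<open>m * q\<close>.\<close>

lemma closed_walk_length:
  assumes "x \<in> I" "y \<in> I" "A x y > 0" "y \<noteq> succ x" "W k y x > 0" "k + 1 \<le> q * d"
  shows "k + 1 = q * d - z"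
proof (rule ccontr)
  assume ne: "k + 1 \<noteq> q * d - z"
  have "W (Suc k) x x > 0" by (rule W_edge_pos[OF assms(1,2,1,3,5)])
  then have "q dvd Suc k" using no_closed_walk[OF assms(1), of "Suc k"] ne assms(6) by fastforce
  then obtain m where m: "Suc k = m * q" by (metis dvd_def mult.commute)
  then obtain m' where m': "m = Suc m'" by (cases m) auto
  have md: "m \<le> d" using m assms(6) q by (simp add: mult.commute)
  have k: "k = (q - 1) + m' * q" using m q by (simp add: m')
  \<comment> \<open>Sort the closed walks by their first step: those through \<open>succ x\<close>
    already exhaust \<open>\<beta> ^ m\<close>, leaving nothing for \<open>y\<close>.\<close>
  have "(\<Sum>v\<in>{succ x, y}. A x v * W k v x) \<le> (\<Sum>v\<in>I. A x v * W k v x)"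
    using assms succ_in[OF assms(1)] nonneg W_nonneg by (intro sum_mono2 finI) auto
  also have "\<dots> = \<beta> ^ m"
    using walk_Suc_left[OF finI assms(1,1), of A k] m W_mult[OF assms(1) md] by simp
  finally have "A x (succ x) * W k (succ x) x + A x y * W k y x \<le> \<beta> ^ m" using assms(4) by simp
  moreover have "\<beta> ^ m \<le> A x (succ x) * W k (succ x) x"
  proof -
    have "W q x x = A x (succ x) * W (q - 1) (succ x) x"
      using it_back[OF assms(1), of 1] q by simp
    then have "\<beta> ^ m = A x (succ x) * (W (q - 1) (succ x) x * W (m' * q) x x)"
      using W_q[OF assms(1)] W_mult[OF assms(1), of m'] md m' by simp
    also have "\<dots> \<le> A x (succ x) * W k (succ x) x"
      unfolding k using W_add_ge[OF succ_in[OF assms(1)] assms(1,1), of "q - 1" "m' * q"]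
        succ_edge[OF assms(1)] by (simp add: mult_left_mono)
    finally show ?thesis .
  qed
  moreover have "A x y * W k y x > 0" using assms by simp
  ultimately show False by linarith
qed

section \<open>Exits from a cycle and coordinates on it\<close>

definition exit :: "'i \<Rightarrow> 'i \<Rightarrow> bool" where
  "exit x y \<longleftrightarrow> x \<in> I \<and> y \<in> I \<and> A x y > 0 \<and> y \<noteq> succ x"

lemma exit_length: "exit x y \<Longrightarrow> W k y x > 0 \<Longrightarrow> k + 1 \<le> q * d \<Longrightarrow> k + 1 = q * d - z"
  using closed_walk_length unfolding exit_def by blast

lemma exit_iff:
  assumes "x \<in> I"
  shows "(\<exists>y. exit x y) \<longleftrightarrow> A x (succ x) < 1"
proof -
  have s: "A x (succ x) + (\<Sum>y\<in>I - {succ x}. A x y) = 1"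
    using rows[OF assms] sum.remove[OF finI succ_in[OF assms], of "A x"] by simp
  have nn: "\<forall>y\<in>I - {succ x}. 0 \<le> A x y" using nonneg assms by auto
  have "(\<Sum>y\<in>I - {succ x}. A x y) = 0 \<longleftrightarrow> (\<forall>y\<in>I - {succ x}. A x y = 0)"
    using nn finI by (intro sum_nonneg_eq_0_iff) auto
  also have "\<dots> \<longleftrightarrow> \<not> (\<exists>y. exit x y)"
    using nn assms by (force simp: exit_def)
  finally show ?thesis using s sum_nonneg[of "I - {succ x}" "A x"] nn by fastforce
qed

lemma succ_le_1:
  assumes "x \<in> I" shows "A x (succ x) \<le> 1"
  using rows[OF assms] member_le_sum[of "succ x" I "A x"] finI succ_in[OF assms] nonneg assms by auto

text \<open>Without an exit all weights along the cycle would be 1, but their product is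
  \<open>\<beta> < 1\<close>.\<close>

lemma exit_ex:
  assumes "x \<in> I"
  obtains i y where "i < q" "exit ((succ ^^ i) x) y"
proof -
  have "\<exists>i<q. A ((succ ^^ i) x) (succ ((succ ^^ i) x)) < 1"
  proof (rule ccontr)
    assume "\<not> ?thesis"
    then have "\<forall>i<q. A ((succ ^^ i) x) (succ ((succ ^^ i) x)) = 1"
      using succ_le_1[OF it_in[OF assms]] by (metis linorder_not_less order_antisym)
    then have "(\<Prod>i<q. A ((succ ^^ i) x) (succ ((succ ^^ i) x))) = 1" by simp
    then show False using prod_orbit[OF assms] \<beta> by simp
  qed
  then show ?thesis using that exit_iff[OF it_in[OF assms]] by blast
qed

text \<open>An integer coordinate on the cycle of \<open>x\<close>, periodic modulo
  \<open>q\<close>, so that steps backwards make sense.\<close>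

definition pt :: "'i \<Rightarrow> int \<Rightarrow> 'i" where
  "pt x i = (succ ^^ nat (i mod int q)) x"

lemma pt_in: "x \<in> I \<Longrightarrow> pt x i \<in> I"
  by (simp add: pt_def it_in)

lemma pt_cong: "i mod int q = j mod int q \<Longrightarrow> pt x i = pt x j"
  by (simp add: pt_def)

lemma pt_0: "pt x 0 = x"
  by (simp add: pt_def)

lemma pt_succ:
  assumes "x \<in> I" shows "succ (pt x i) = pt x (i + 1)"
proof -
  define r where "r = i mod int q"
  have r: "0 \<le> r" "r < int q" using q by (auto simp: r_def)
  have e: "(i + 1) mod int q = (r + 1) mod int q" unfolding r_def by (simp add: mod_add_left_eq)
  show ?thesis
  proof (cases "r = int q - 1")
    case True
    have "Suc (nat r) = q" using True q by auto
    then have "succ ((succ ^^ nat r) x) = x" using it_period[OF assms] by (metis funpow.simps(2) o_apply)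
    then show ?thesis unfolding pt_def e using True by (simp add: r_def)
  next
    case False
    then have "(r + 1) mod int q = r + 1" using r by simp
    moreover have "nat (r + 1) = Suc (nat r)" using r by simp
    ultimately show ?thesis unfolding pt_def e by (simp add: r_def)
  qed
qed

lemma pt_it:
  assumes "x \<in> I" shows "(succ ^^ k) (pt x i) = pt x (i + int k)"
  by (induction k) (simp_all add: pt_succ[OF assms] ac_simps)

lemma it_pt: "x \<in> I \<Longrightarrow> (succ ^^ k) x = pt x (int k)"
  using pt_it[of x k 0] by (simp add: pt_0)

lemma pt_pt:
  assumes "x \<in> I" shows "pt (pt x i) j = pt x (i + j)"
  unfolding pt_def[of "pt x i"] pt_it[OF assms] using q
  by (intro pt_cong) (simp add: mod_add_right_eq)

lemma pt_walk:
  assumes "x \<in> I"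
  shows "W (nat ((j - i) mod int q)) (pt x i) (pt x j) > 0"
proof -
  have "(succ ^^ nat ((j - i) mod int q)) (pt x i) = pt x j"
    unfolding pt_it[OF assms] using q by (intro pt_cong) (simp add: mod_add_right_eq)
  then show ?thesis using it_walk[OF pt_in[OF assms], of "nat ((j - i) mod int q)" i] by simp
qed

lemma pt_eq_iff:
  assumes "x \<in> I" shows "pt x i = pt x j \<longleftrightarrow> i mod int q = j mod int q"
proof
  assume eq: "pt x i = pt x j"
  define r where "r = (j - i) mod int q"
  have r: "0 \<le> r" "r < int q" using q by (auto simp: r_def)
  have "pt (pt x i) r = pt x j"
    unfolding pt_pt[OF assms] by (rule pt_cong) (simp add: r_def mod_add_right_eq)
  then have "pt (pt x i) r = pt x i" using eq by simp
  then have "(succ ^^ nat r) (pt x i) = pt x i" using r by (simp add: pt_def)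
  then have "r = 0" using it_neq[OF pt_in[OF assms], of "nat r" i] r by force
  then show "i mod int q = j mod int q"
    unfolding r_def by (metis mod_eq_dvd_iff mod_0_imp_dvd)
qed (rule pt_cong)

section \<open>The ring of levels\<close>

definition orbit_rel :: "'i \<Rightarrow> 'i \<Rightarrow> bool" where
  "orbit_rel u v \<longleftrightarrow> u \<in> I \<and> v \<in> I \<and> (\<exists>i j. exit (pt u i) (pt v j))"

text \<open>Each cycle visited costs at most \<open>q - 1\<close> steps along it and one for
  leaving. The walk is counted from the target of the first exit, as \<open>exit_length\<close>
  requires.\<close>

lemma orbit_chain:
  assumes "(orbit_rel ^^ Suc k) u v"
  shows "u \<in> I \<and> v \<in> I \<and> (\<exists>i y. exit (pt u i) y \<and> (\<forall>j. \<exists>l < Suc k * q. W l y (pt v j) > 0))"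
  using assms
proof (induction k arbitrary: v)
  case 0
  then obtain i j where ij: "u \<in> I" "v \<in> I" "exit (pt u i) (pt v j)"
    by (auto simp: orbit_rel_def)
  have "\<exists>l < q. W l (pt v j) (pt v j') > 0" for j'
    using pt_walk[OF ij(2), of j' j] q by (intro exI[of _ "nat ((j' - j) mod int q)"]) (simp add: nat_less_iff)
  then show ?case using ij by auto
next
  case (Suc k)
  then obtain v' where v': "(orbit_rel ^^ Suc k) u v'" "orbit_rel v' v" by auto
  from Suc.IH[OF v'(1)] obtain i y where
    y: "u \<in> I" "v' \<in> I" "exit (pt u i) y" "\<And>j. \<exists>l < Suc k * q. W l y (pt v' j) > 0" by blast
  from v'(2) obtain i' j' where ij: "v \<in> I" "exit (pt v' i') (pt v j')" by (auto simp: orbit_rel_def)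
  from y(4) obtain l where l: "l < Suc k * q" "W l y (pt v' i') > 0" by blast
  have yI: "y \<in> I" using y(3) by (simp add: exit_def)
  have "\<exists>l < Suc (Suc k) * q. W l y (pt v j) > 0" for j
  proof (intro exI conjI)
    let ?m = "nat ((j - j') mod int q)"
    show "W (l + Suc ?m) y (pt v j) > 0"
      by (rule W_add_pos[OF yI pt_in[OF y(2)] pt_in[OF ij(1)] l(2)],
          rule W_edge_pos[OF pt_in[OF y(2)] pt_in[OF ij(1)] pt_in[OF ij(1)] _ pt_walk[OF ij(1)]])
        (use ij(2) in \<open>simp add: exit_def\<close>)
    have "?m < q" using q by (simp add: nat_less_iff)
    then show "l + Suc ?m < Suc (Suc k) * q" using l(1) by simp
  qed
  then show ?case using y(1,3) ij(1) by blast
qed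

text \<open>A return to the starting cycle after fewer than \<open>d\<close> exits gives a closed
  walk with an exit of length at most \<open>(d - 1) * q < q * d - z\<close>.\<close>

lemma orbit_chain_closed:
  assumes "(orbit_rel ^^ k) u (pt u m)" "0 < k" shows "d \<le> k"
proof (rule ccontr)
  assume "\<not> d \<le> k"
  obtain k' where k': "k = Suc k'" using assms(2) by (cases k) auto
  from orbit_chain[OF assms(1)[unfolded k']] obtain i y where
    y: "u \<in> I" "exit (pt u i) y" "\<And>j. \<exists>l < Suc k' * q. W l y (pt (pt u m) j) > 0" by blast
  \<comment> \<open>The coordinate \<open>i - m\<close> relative to \<open>pt u m\<close> is the
    point \<open>pt u i\<close> of the first exit, so the walk closes there.\<close>
  from y(3)[of "i - m"] obtain l where l: "l < Suc k' * q" "W l y (pt u i) > 0"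
    by (auto simp: pt_pt[OF y(1)])
  have "Suc k' * q \<le> (d - 1) * q" using \<open>\<not> d \<le> k\<close> k' by (intro mult_le_mono1) simp
  then show False using exit_length[OF y(2) l(2)] l(1) qd by linarith
qed

text \<open>The base point on the next cycle is chosen so that some exit preserves the
  coordinate.\<close>

definition nxt :: "'i \<Rightarrow> 'i" where
  "nxt u = (SOME v. v \<in> I \<and> (\<exists>i. exit (pt u i) (pt v i)))"

lemma nxt:
  assumes "u \<in> I"
  shows nxt_in: "nxt u \<in> I" and nxt_exit: "\<exists>i. exit (pt u i) (pt (nxt u) i)"
proof -
  obtain i y where iy: "exit ((succ ^^ i) u) y" using exit_ex[OF assms] by blast
  then have y: "y \<in> I" by (simp add: exit_def)
  have "exit (pt u (int i)) (pt (pt y (- int i)) (int i))"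
    using iy by (simp add: it_pt[OF assms] pt_pt[OF y] pt_0)
  then have "\<exists>v. v \<in> I \<and> (\<exists>i. exit (pt u i) (pt v i))" using pt_in[OF y] by blast
  from someI_ex[OF this] show "nxt u \<in> I" "\<exists>i. exit (pt u i) (pt (nxt u) i)"
    by (auto simp: nxt_def)
qed

text \<open>Levels are read modulo \<open>d\<close>; hence the coordinates are aligned between
  successive levels except from \<open>d - 1\<close> back to 0.\<close>

definition lev :: "nat \<Rightarrow> 'i" where
  "lev t = (nxt ^^ (t mod d)) (SOME x. x \<in> I)"

lemma lev_in: "lev t \<in> I"
proof -
  have "I \<noteq> {}" using cardI q d by auto
  then have x: "(SOME x. x \<in> I) \<in> I" using some_in_eq by blast
  have "(nxt ^^ k) (SOME x. x \<in> I) \<in> I" for k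
    by (induction k) (auto simp: x nxt_in)
  then show ?thesis by (simp add: lev_def)
qed

lemma lev_mod: "lev (t mod d) = lev t" "lev (t + d) = lev t"
  by (simp_all add: lev_def)

lemma lev_Suc: "t + 1 < d \<Longrightarrow> lev (t + 1) = nxt (lev t)"
  by (simp add: lev_def)

lemma lev_chain: "s + k < d \<Longrightarrow> (orbit_rel ^^ k) (lev s) (lev (s + k))"
proof (induction k)
  case (Suc k)
  have "orbit_rel (lev (s + k)) (lev (s + k + 1))"
    unfolding orbit_rel_def lev_Suc[of "s + k", simplified, OF Suc.prems[simplified]]
      Suc_eq_plus1[symmetric]
    using nxt_exit[OF lev_in] nxt_in[OF lev_in] lev_in by blast
  then show ?case using Suc by auto
qed simp

text \<open>Two levels on the same cycle would close a chain of fewer than \<open>d\<close>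
  exits.\<close>

lemma lev_inj:
  assumes "s < d" "t < d" "pt (lev s) i = pt (lev t) j"
  shows "s = t"
proof -
  have *: False if "s < t" "t < d" "pt (lev s) i = pt (lev t) j" for s t i j
  proof -
    have "lev t = pt (lev t) (j + (- j))" by (simp add: pt_0)
    also have "\<dots> = pt (lev s) (i - j)" using that(3) by (metis pt_pt lev_in diff_conv_add_uminus)
    finally have "d \<le> t - s"
      using lev_chain[of s "t - s"] orbit_chain_closed[of "t - s" "lev s" "i - j"] that by simp
    then show False using that by simp
  qed
  show ?thesis using *[of s t i j] *[of t s j i] assms by (metis linorder_neqE_nat)
qed

text \<open>Injectivity suffices, since both sides have \<open>q * d\<close> elements.\<close>

lemma bij_pt: "bij_betw (\<lambda>(t, i). pt (lev t) i) ({..<d} \<times> {0..<int q}) I"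
proof -
  have inj: "inj_on (\<lambda>(t, i). pt (lev t) i) ({..<d} \<times> {0..<int q})"
  proof (rule inj_onI, clarify)
    fix t i t' i' assume *: "t < d" "t' < d" "i \<in> {0..<int q}" "i' \<in> {0..<int q}"
      "pt (lev t) i = pt (lev t') i'"
    then have "t = t'" using lev_inj by simp
    then have "i mod int q = i' mod int q" using *(5) pt_eq_iff[OF lev_in] by simp
    then show "t = t' \<and> i = i'" using \<open>t = t'\<close> *(3,4) by simp
  qed
  moreover have "(\<lambda>(t, i). pt (lev t) i) ` ({..<d} \<times> {0..<int q}) = I"
  proof (rule card_subset_eq[OF finI])
    show "card ((\<lambda>(t, i). pt (lev t) i) ` ({..<d} \<times> {0..<int q})) = card I"
      using card_image[OF inj] cardI by (simp add: card_cartesian_product mult.commute)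
  qed (auto simp: pt_in lev_in)
  ultimately show ?thesis by (simp add: bij_betw_def)
qed

lemma ex_pt:
  assumes "x \<in> I" obtains t i where "t < d" "0 \<le> i" "i < int q" "x = pt (lev t) i"
  using assms bij_pt unfolding bij_betw_def by fastforce

text \<open>An exit from the last level to level \<open>t\<close> closes a chain of
  \<open>d - t\<close> exits, so \<open>t = 0\<close>.\<close>

lemma lev_wrap: "orbit_rel (lev (d - 1)) (lev 0)"
proof -
  obtain i y where iy: "i < q" "exit ((succ ^^ i) (lev (d - 1))) y" using exit_ex[OF lev_in] by blast
  then have "y \<in> I" by (simp add: exit_def)
  then obtain t j where tj: "t < d" "y = pt (lev t) j" using ex_pt by metis
  have r: "orbit_rel (lev (d - 1)) (lev t)"
    using iy(2) tj(2) lev_in by (auto simp: it_pt[OF lev_in] orbit_rel_def)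
  have "(orbit_rel ^^ Suc (d - 1 - t)) (lev t) (pt (lev t) 0)"
    using lev_chain[of t "d - 1 - t"] r tj(1) d by (auto simp: pt_0)
  from orbit_chain_closed[OF this] have "t = 0" using d by simp
  then show ?thesis using r by simp
qed

lemma lev_step: "orbit_rel (lev t) (lev (t + 1))"
proof (cases "t mod d + 1 < d")
  case True
  then have "orbit_rel (lev (t mod d)) (lev (t mod d + 1))"
    using lev_chain[of "t mod d" 1] by (simp add: eq_OO)
  then show ?thesis using True by (metis lev_mod(1) mod_add_left_eq)
next
  case False
  then have "t mod d = d - 1" using d mod_less_divisor[of d t] by linarith
  moreover from this have "(t + 1) mod d = 0" using d by (metis mod_add_left_eq le_add_diff_inverse2 mod_self one_le_numeral order_trans)
  ultimately show ?thesis using lev_wrap by (metis lev_mod(1))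
qed

lemma lev_chain': "(orbit_rel ^^ k) (lev s) (lev (s + k))"
  using lev_step by (induction k) auto

text \<open>If the exit leads to level \<open>s\<close>, the ring brings one back from
  \<open>s\<close> with \<open>k < d\<close> exits; the closed chain needs
  \<open>k + 1 \<ge> d\<close>, which fixes \<open>s\<close>.\<close>

lemma exit_level:
  assumes "exit (pt (lev t) i) y"
  obtains j where "0 \<le> j" "j < int q" "y = pt (lev (t + 1)) j"
proof -
  have "y \<in> I" using assms by (simp add: exit_def)
  then obtain s j where sj: "s < d" "0 \<le> j" "j < int q" "y = pt (lev s) j" using ex_pt by metis
  have r: "orbit_rel (lev t) (lev s)" using assms sj(4) lev_in by (auto simp: orbit_rel_def)
  define k where "k = (t + d - s) mod d"
  have "k < d" using d by (simp add: k_def)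
  have "(s + k) mod d = t mod d"
    unfolding k_def using sj(1) by (simp add: mod_add_right_eq)
  then have "lev (s + k) = lev t" by (metis lev_mod(1))
  then have "(orbit_rel ^^ Suc k) (lev s) (pt (lev s) 0)"
    using lev_chain'[of k s] r by (auto simp: pt_0)
  from orbit_chain_closed[OF this] have "Suc k = d" using \<open>k < d\<close> by simp
  have "s mod d = (t + 1) mod d"
  proof -
    have "(t + 1) mod d = (t mod d + 1) mod d" by (simp only: mod_add_left_eq)
    also have "\<dots> = (s + k + 1) mod d" using \<open>(s + k) mod d = t mod d\<close> by (metis mod_add_left_eq)
    also have "s + k + 1 = s + d" using \<open>Suc k = d\<close> by simp
    finally show ?thesis by simp
  qed
  then have "lev s = lev (t + 1)" by (metis lev_mod(1))
  then show ?thesis using that sj by simp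
qed

lemma lev_exit:
  assumes "t < d"
  shows "\<exists>i j. exit (pt (lev t) i) (pt (lev (t + 1)) j) \<and> (t < d - 1 \<longrightarrow> i = j)"
proof (cases "t < d - 1")
  case True
  then have "lev (t + 1) = nxt (lev t)" by (intro lev_Suc) simp
  then show ?thesis using nxt_exit[OF lev_in] by metis
next
  case False
  then show ?thesis using lev_step[of t] by (auto simp: orbit_rel_def)
qed

section \<open>Lengths of closed walks around the ring\<close>

text \<open>The walk leaves level \<open>t\<close> at \<open>i t\<close>, lands at
  \<open>j t\<close> and follows the cycle to \<open>i (Suc t)\<close>; the first exit edge is not
  counted.\<close>

lemma exit_seq:
  assumes "\<And>t. t \<le> m \<Longrightarrow> exit (pt (lev t) (i t)) (pt (lev (Suc t)) (j t))"
  shows "W ((\<Sum>t<m. nat ((i (Suc t) - j t) mod int q) + 1) + nat ((i (Suc m) - j m) mod int q))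
    (pt (lev 1) (j 0)) (pt (lev (Suc m)) (i (Suc m))) > 0"
  using assms
proof (induction m)
  case 0
  then show ?case using pt_walk[OF lev_in] by simp
next
  case (Suc m)
  let ?n = "\<lambda>t. nat ((i (Suc t) - j t) mod int q)"
  note P = pt_in[OF lev_in]
  have 1: "W ((\<Sum>t<m. ?n t + 1) + ?n m) (pt (lev 1) (j 0)) (pt (lev (Suc m)) (i (Suc m))) > 0"
    using Suc by simp
  have "exit (pt (lev (Suc m)) (i (Suc m))) (pt (lev (Suc (Suc m))) (j (Suc m)))" using Suc.prems by simp
  then have 2: "W (Suc (?n (Suc m))) (pt (lev (Suc m)) (i (Suc m))) (pt (lev (Suc (Suc m))) (i (Suc (Suc m)))) > 0"
    using W_edge_pos[OF P P P _ pt_walk[OF lev_in]] by (simp add: exit_def)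
  show ?case using W_add_pos[OF P P P 1 2] by (simp add: ac_simps)
qed

lemma exit_cycle:
  assumes "0 < m" "lev m = lev 0" "i m = i 0"
    and ex: "\<And>t. t < m \<Longrightarrow> exit (pt (lev t) (i t)) (pt (lev (Suc t)) (j t))"
    and le: "(\<Sum>t<m. (i (Suc t) - j t) mod int q) + int m \<le> int (q * d)"
  shows "(\<Sum>t<m. (i (Suc t) - j t) mod int q) + int m = int (q * d) - int z"
proof -
  obtain m' where m: "m = Suc m'" using assms(1) by (cases m) auto
  let ?n = "\<lambda>t. nat ((i (Suc t) - j t) mod int q)"
  define k where "k = (\<Sum>t<m'. ?n t + 1) + ?n m'"
  have k: "int (k + 1) = (\<Sum>t<m. (i (Suc t) - j t) mod int q) + int m"
    using q by (simp add: k_def m sum.distrib)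
  have "W k (pt (lev 1) (j 0)) (pt (lev m) (i m)) > 0"
    unfolding k_def m by (rule exit_seq) (use ex m in simp)
  then have "W k (pt (lev 1) (j 0)) (pt (lev 0) (i 0)) > 0" using assms by simp
  moreover have "exit (pt (lev 0) (i 0)) (pt (lev 1) (j 0))" using ex[of 0] assms(1) by simp
  ultimately have "k + 1 = q * d - z" using exit_length k le by (metis of_nat_le_iff)
  then show ?thesis using k qd by (simp add: of_nat_diff)
qed

text \<open>In one turn each stretch along a cycle is at most \<open>q - 1\<close>, so the length
  bound \<open>q * d\<close> of \<open>exit_cycle\<close> holds by itself.\<close>

lemma cycle_sum:
  assumes "i d = i 0" "\<And>t. t < d \<Longrightarrow> exit (pt (lev t) (i t)) (pt (lev (Suc t)) (j t))"
  shows "(\<Sum>t<d. (i (Suc t) - j t) mod int q) + int d = int (q * d) - int z"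
proof (rule exit_cycle)
  show "lev d = lev 0" using lev_mod(2)[of 0] by simp
  have "(i (Suc t) - j t) mod int q \<le> int q - 1" for t
    using q pos_mod_bound[of "int q" "i (Suc t) - j t"] by simp
  then have "(\<Sum>t<d. (i (Suc t) - j t) mod int q) \<le> (\<Sum>t<d. int q - 1)" by (rule sum_mono)
  then show "(\<Sum>t<d. (i (Suc t) - j t) mod int q) + int d \<le> int (q * d)"
    by (simp add: algebra_simps)
qed (use assms d in auto)

text \<open>Modulo \<open>q\<close> the positions \<open>i t\<close> telescope around the ring, and
  only the jumps \<open>j t - i t\<close> remain.\<close>

lemma cycle_mod:
  assumes "\<And>t. t < d \<Longrightarrow> exit (pt (lev t) (i t)) (pt (lev (Suc t)) (j t))"
  shows "int q dvd (\<Sum>t<d. j t - i t) - int (d + z)"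
proof -
  \<comment> \<open>The position after the last level is reset to \<open>i 0\<close> so that the
    walk closes up.\<close>
  define i' where "i' = i(d := i 0)"
  have 1: "(\<Sum>t<d. (i' (Suc t) - j t) mod int q) + int d = int (q * d) - int z"
    using d by (intro cycle_sum) (use assms in \<open>auto simp: i'_def\<close>)
  have "(\<Sum>t<d. i' (Suc t)) + i' 0 = (\<Sum>t<d. i' t) + i' d"
    using sum.lessThan_Suc_shift[of i' d] by simp
  moreover have "i' d = i' 0" using d by (simp add: i'_def)
  moreover have "(\<Sum>t<d. i' t) = (\<Sum>t<d. i t)" by (simp add: i'_def)
  ultimately have 2: "(\<Sum>t<d. j t - i t) = - (\<Sum>t<d. i' (Suc t) - j t)"
    by (simp add: sum_subtractf)
  have "int q dvd (\<Sum>t<d. i' (Suc t) - j t) - (\<Sum>t<d. (i' (Suc t) - j t) mod int q)"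
    unfolding sum_subtractf[symmetric] by (intro dvd_sum) (simp add: mod_eq_dvd_iff[symmetric])
  moreover have "(\<Sum>t<d. (i' (Suc t) - j t) mod int q) = int q * int d - int z - int d" using 1 by simp
  ultimately have "int q dvd (\<Sum>t<d. i' (Suc t) - j t) - (int q * int d - int z - int d)" by metis
  then have "int q dvd - ((\<Sum>t<d. i' (Suc t) - j t) - (int q * int d - int z - int d)) - int q * int d"
    by (intro dvd_diff dvd_triv_left) (simp only: dvd_minus_iff)
  also have "\<dots> = (\<Sum>t<d. j t - i t) - int (d + z)" unfolding 2 by simp
  finally show ?thesis .
qed

text \<open>The aligned base points collect the whole rotation of a turn at the last level.\<close>

definition shift :: "nat \<Rightarrow> int" where
  "shift t = (if t = d - 1 then int (d + z) else 0)"

text \<open>Replacing one exit in an aligned turn by the given one leaves the total jump unchanged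
  modulo \<open>q\<close>, so both exits jump equally far.\<close>

lemma exit_shift:
  assumes t: "t < d" and ex: "exit (pt (lev t) i) (pt (lev (Suc t)) j)"
  shows "int q dvd j - i - shift t"
proof -
  from lev_exit obtain i0 j0 where ij: "\<And>t. t < d \<Longrightarrow> exit (pt (lev t) (i0 t)) (pt (lev (Suc t)) (j0 t))"
    "\<And>t. t < d - 1 \<Longrightarrow> i0 t = j0 t" unfolding Suc_eq_plus1 by (metis diff_le_self less_le_trans)
  have sum: "(\<Sum>s<d. j0 s - i0 s) = j0 (d - 1) - i0 (d - 1)"
  proof -
    have "(\<Sum>s<Suc (d - 1). j0 s - i0 s) = j0 (d - 1) - i0 (d - 1)" by (simp add: ij(2))
    then show ?thesis using d by simp
  qed
  have 1: "int q dvd (\<Sum>s<d. j0 s - i0 s) - int (d + z)" by (rule cycle_mod[OF ij(1)])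
  have 2: "int q dvd (\<Sum>s<d. (j0(t := j)) s - (i0(t := i)) s) - int (d + z)"
    using ij(1) ex by (intro cycle_mod) auto
  have "(\<Sum>s<d. (j0(t := j)) s - (i0(t := i)) s) = (j - i) + (\<Sum>s\<in>{..<d} - {t}. j0 s - i0 s)"
    using t by (subst sum.remove[of _ t]) auto
  moreover have "(\<Sum>s<d. j0 s - i0 s) = (j0 t - i0 t) + (\<Sum>s\<in>{..<d} - {t}. j0 s - i0 s)"
    using t by (subst sum.remove[of _ t]) auto
  ultimately have "(j - i) - (j0 t - i0 t) =
      ((\<Sum>s<d. (j0(t := j)) s - (i0(t := i)) s) - int (d + z)) - ((\<Sum>s<d. j0 s - i0 s) - int (d + z))"
    by simp
  then have 3: "int q dvd (j - i) - (j0 t - i0 t)" using dvd_diff[OF 2 1] by simp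
  show ?thesis
  proof (cases "t = d - 1")
    case True
    have e: "j - i - shift t = ((j - i) - (j0 t - i0 t)) + ((\<Sum>s<d. j0 s - i0 s) - int (d + z))"
      unfolding sum True shift_def by simp
    show ?thesis unfolding e by (rule dvd_add[OF 3 1])
  next
    case False
    then show ?thesis using 3 ij(2)[of t] t by (simp add: shift_def)
  qed
qed

text \<open>Consequently an index has at most one exit edge, which \<open>matrix_eq\<close> needs to
  compute its weight.\<close>

lemma exit_target:
  assumes "t < d" "exit (pt (lev t) i) y"
  shows "y = pt (lev (Suc t)) (i + shift t)"
proof -
  obtain j where j: "y = pt (lev (Suc t)) j" using exit_level[OF assms(2)] by auto
  have "int q dvd j - (i + shift t)" using exit_shift[OF assms(1)] assms(2) j by (simp add: algebra_simps)
  then show ?thesis unfolding j by (intro pt_cong) (simp add: mod_eq_dvd_iff)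
qed

definition exits :: "nat \<Rightarrow> int set" where
  "exits t = {i \<in> {0..<int q}. \<exists>y. exit (pt (lev t) i) y}"

lemma exits_exit: "t < d \<Longrightarrow> i \<in> exits t \<Longrightarrow> exit (pt (lev t) i) (pt (lev (Suc t)) (i + shift t))"
  using exit_target unfolding exits_def by blast

lemma exits_nonempty: "t < d \<Longrightarrow> exits t \<noteq> {}"
proof -
  assume "t < d"
  then obtain i y where "exit (pt (lev t) i) y" using lev_exit by blast
  moreover have "pt (lev t) i = pt (lev t) (i mod int q)" by (rule pt_cong) simp
  ultimately have "i mod int q \<in> exits t" using q by (auto simp: exits_def)
  then show ?thesis by blast
qed

text \<open>The number of steps along the next cycle from the landing point of exit \<open>i\<close>
  to exit \<open>j\<close>.\<close>

definition cost :: "nat \<Rightarrow> int \<Rightarrow> int \<Rightarrow> int" where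
  "cost t i j = (j - i - shift t) mod int q"

lemma cost_sum:
  assumes "\<And>t. t < d \<Longrightarrow> f t \<in> exits t"
  shows "(\<Sum>t<d. cost t (f t) (f (Suc t mod d))) = int (q * d) - int z - int d"
proof -
  have "(\<Sum>t<d. (f (Suc t mod d) - (f (t mod d) + shift t)) mod int q) + int d = int (q * d) - int z"
    by (rule cycle_sum[of "\<lambda>t. f (t mod d)"]) (use assms exits_exit d in auto)
  moreover have "(\<Sum>t<d. (f (Suc t mod d) - (f (t mod d) + shift t)) mod int q)
      = (\<Sum>t<d. cost t (f t) (f (Suc t mod d)))"
    by (intro sum.cong refl) (simp add: cost_def diff_diff_eq)
  ultimately show ?thesis by simp
qed

text \<open>With two levels, two turns with different exits form one closed walk of four exits, to
  which \<open>exit_cycle\<close> applies if it is short enough.\<close>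

lemma cost_two:
  assumes "d = 2" "i \<in> exits 0" "i' \<in> exits 0" "j \<in> exits 1" "j' \<in> exits 1"
    and le: "cost 0 i j + cost 1 j i' + cost 0 i' j' + cost 1 j' i + 4 \<le> 2 * int q"
  shows "cost 0 i j + cost 1 j i' + cost 0 i' j' + cost 1 j' i + 4 = 2 * int q - int z"
proof -
  define f where "f = (!) [i, j, i', j', i]"
  define g where "g t = f t + shift (t mod 2)" for t
  have four: "{..<4::nat} = {0, 1, 2, 3}" by auto
  have f: "f 0 = i" "f (Suc 0) = j" "f 2 = i'" "f 3 = j'" "f 4 = i" by (simp_all add: f_def)
  have lev2: "lev 2 = lev 0" "lev 3 = lev 1" "lev 4 = lev 0"
    using lev_mod(1)[of 2] lev_mod(1)[of 3] lev_mod(1)[of 4] assms(1) by (simp_all add: mod_Suc_eq)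
  have E0: "exit (pt (lev 0) k) (pt (lev (Suc 0)) (k + shift 0))" if "k \<in> exits 0" for k
    using exits_exit[of 0 k] that d by simp
  have E1: "exit (pt (lev (Suc 0)) k) (pt (lev 0) (k + shift (Suc 0)))" if "k \<in> exits (Suc 0)" for k
    using exits_exit[of 1 k] that d lev2(1) by (simp flip: numeral_2_eq_2)
  have s: "(\<Sum>t<4. (f (Suc t) - g t) mod int q) + int 4 =
      cost 0 i j + cost 1 j i' + cost 0 i' j' + cost 1 j' i + 4"
    unfolding four by (simp add: f g_def cost_def diff_diff_eq numeral_3_eq_3[symmetric] numeral_2_eq_2[symmetric])
  have "(\<Sum>t<4. (f (Suc t) - g t) mod int q) + int 4 = int (q * d) - int z"
  proof (rule exit_cycle)
    fix t :: nat assume "t < 4"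
    then consider "t = 0" | "t = 1" | "t = 2" | "t = 3" by linarith
    then show "exit (pt (lev t) (f t)) (pt (lev (Suc t)) (g t))"
      by cases (simp_all add: f g_def lev2 E0 E1 assms(2-5)[simplified]
          numeral_3_eq_3[symmetric] numeral_2_eq_2[symmetric])
  next
    show "(\<Sum>t<4. (f (Suc t) - g t) mod int q) + int 4 \<le> int (q * d)"
      unfolding s using le assms(1) by simp
  qed (simp_all add: lev2 f)
  then show ?thesis unfolding s using assms(1) by simp
qed

section \<open>Recovering the matrix entries\<close>

definition wt :: "nat \<Rightarrow> int \<Rightarrow> real" where
  "wt t i = A (pt (lev t) i) (succ (pt (lev t) i))"

lemma weight_condition: "weight_condition q d \<beta> exits wt"
  unfolding weight_condition_def
proof (intro allI impI conjI ballI)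
  fix t i assume t: "t < d"
  note P = pt_in[OF lev_in]
  show "0 < wt t i" by (simp add: wt_def succ_edge P)
  show "wt t i < 1" if "i \<in> exits t" using that exit_iff[OF P] by (auto simp: exits_def wt_def)
  show one: "wt t i = 1" if "i \<in> {0..<int q} - exits t" for i
    using that exit_iff[OF P, of t i] succ_le_1[OF P, of t i] by (auto simp: exits_def wt_def)
  have "(\<Prod>i\<in>exits t. wt t i) = (\<Prod>i\<in>{0..<int q}. wt t i)"
    using one by (intro prod.mono_neutral_left) (auto simp: exits_def)
  also have "\<dots> = (\<Prod>j\<in>{0..<q}. wt t (int j))"
    using prod.reindex_bij_betw[OF bij_betw_residues[of q 0 0], of "wt t"] q by simp
  also have "\<dots> = \<beta>"
    using prod_orbit[OF lev_in, of t] by (simp add: wt_def it_pt[OF lev_in] lessThan_atLeast0)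
  finally show "(\<Prod>i\<in>exits t. wt t i) = \<beta>" .
qed

text \<open>Apart from the edge along the cycle a row has at most one nonzero entry, so the row sum
  determines it.\<close>

lemma matrix_eq:
  assumes t: "t < d" "t' < d" and i: "i \<in> {0..<int q}" "i' \<in> {0..<int q}"
  shows "A (pt (lev t) i) (pt (lev t') i') = cyclic_mat q d (d + z) exits wt (t, i) (t', i')"
proof -
  let ?x = "pt (lev t) i" and ?y = "pt (lev t') i'"
  note P = pt_in[OF lev_in]
  have eq: "pt (lev s) j = pt (lev s') j' \<longleftrightarrow> s mod d = s' mod d \<and> j mod int q = j' mod int q" for s s' j j'
  proof
    assume e: "pt (lev s) j = pt (lev s') j'"
    then have "pt (lev (s mod d)) j = pt (lev (s' mod d)) j'" by (simp only: lev_mod)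
    then have "s mod d = s' mod d" by (rule lev_inj[rotated 2]) (use d in simp_all)
    moreover from this have "lev s = lev s'" using lev_mod(1) by metis
    ultimately show "s mod d = s' mod d \<and> j mod int q = j' mod int q"
      using e pt_eq_iff[OF lev_in] by simp
  next
    assume e: "s mod d = s' mod d \<and> j mod int q = j' mod int q"
    then have l: "lev s = lev s'" using lev_mod(1) by metis
    show "pt (lev s) j = pt (lev s') j'" unfolding l by (rule pt_cong) (use e in simp)
  qed
  have loop: "?y = succ ?x \<longleftrightarrow> t' = t \<and> i' = (i + 1) mod int q"
    unfolding pt_succ[OF lev_in] eq using t i by auto
  have target: "?y = pt (lev (Suc t)) (i + shift t) \<longleftrightarrow>
      t' = Suc t mod d \<and> i' = (i + shift t) mod int q"
    unfolding eq using t i by auto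
  show ?thesis
  proof (cases "?y = succ ?x")
    case True
    then show ?thesis using loop by (simp add: cyclic_mat_def wt_def)
  next
    case ns: False
    have zero: "A ?x y = 0" if "y \<in> I" "y \<noteq> succ ?x" "\<not> exit ?x y" for y
      using that nonneg[OF P that(1), of t i] P by (force simp: exit_def)
    have ex_iff: "(t' = Suc t mod d \<and> i' = (i + shift t) mod int q \<and> i \<in> exits t) \<longleftrightarrow> exit ?x ?y"
      using target exits_exit[OF t(1), of i] exit_target[OF t(1)] i by (auto simp: exits_def)
    have val: "A ?x ?y = (if exit ?x ?y then 1 - wt t i else 0)"
    proof (cases "exit ?x ?y")
      case True
      have "(\<Sum>y\<in>I. A ?x y) = (\<Sum>y\<in>{succ ?x, ?y}. A ?x y)"
      proof (intro sum.mono_neutral_right finI ballI)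
        fix y assume y: "y \<in> I - {succ ?x, ?y}"
        have "\<not> exit ?x y"
        proof
          assume "exit ?x y"
          then have "y = ?y" using exit_target[OF t(1), of i y] exit_target[OF t(1) True] by simp
          then show False using y by simp
        qed
        then show "A ?x y = 0" using zero[of y] y by blast
      next
        show "{succ ?x, ?y} \<subseteq> I" using P succ_in[OF P] by simp
      qed
      then show ?thesis using rows[OF P, of t i] ns True by (simp add: wt_def)
    next
      case False
      then show ?thesis using zero[OF P ns] by simp
    qed
    show ?thesis
    proof (cases "t = d - 1")
      case True
      then have "Suc t mod d = 0" using d by simp
      then show ?thesis
        using val ex_iff loop ns True by (auto simp: cyclic_mat_def shift_def)
    next
      case False
      then have "Suc t mod d = t + 1" "shift t = 0" using t by (simp_all add: shift_def)
      then show ?thesis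
        using val ex_iff loop ns False t i by (auto simp: cyclic_mat_def)
    qed
  qed
qed

end

section \<open>The exit intervals\<close>

context rigid_matrix
begin

section \<open>Separation of the costs\<close>

lemma cost_bounds: "0 \<le> cost t i j" "cost t i j \<le> int q - 1"
  using q pos_mod_bound[of "int q" "j - i - shift t"] by (simp_all add: cost_def)

lemma cost_dvd: "int q dvd cost t i j - (j - i - shift t)"
  unfolding cost_def by (simp add: mod_eq_dvd_iff[symmetric])

lemma cost_sum_2:
  assumes "d = 2" "i \<in> exits 0" "j \<in> exits 1"
  shows "cost 0 i j + cost 1 j i = 2 * int q - int z - 2"
proof -
  have two: "{..<2::nat} = {0, 1}" by auto
  have "(if t = 0 then i else j) \<in> exits t" if "t < d" for t
    using that assms by (auto simp: less_2_cases_iff)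
  from cost_sum[of "\<lambda>t. if t = 0 then i else j", OF this] show ?thesis
    using assms(1) by (simp add: two)
qed

text \<open>For \<open>d = 2\<close> a single turn does not separate the costs; a closed walk with two turns does.\<close>

lemma cost_separable_2:
  assumes "d = 2" "i \<in> exits 0" "i' \<in> exits 0" "j \<in> exits 1" "j' \<in> exits 1"
  shows "cost 0 i j + cost 0 i' j' = cost 0 i j' + cost 0 i' j"
proof -
  have ge: "0 \<le> cost 0 i j + cost 0 i' j' - cost 0 i j' - cost 0 i' j"
    if ij: "i \<in> exits 0" "i' \<in> exits 0" "j \<in> exits 1" "j' \<in> exits 1" for i i' j j'
  proof (rule ccontr)
    define D where "D = cost 0 i j + cost 0 i' j' - cost 0 i j' - cost 0 i' j"
    assume "\<not> ?thesis"
    then have neg: "D < 0" by (simp add: D_def)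
    note e = cost_sum_2[OF assms(1) ij(1,3)] cost_sum_2[OF assms(1) ij(1,4)]
      cost_sum_2[OF assms(1) ij(2,3)] cost_sum_2[OF assms(1) ij(2,4)]
    \<comment> \<open>By \<open>cost_sum_2\<close> every cost at level 0 is also at least
      \<open>q - 1 - z\<close>.\<close>
    have lo: "- 2 * int z \<le> D"
      unfolding D_def
      using e cost_bounds(2)[of 1 j i] cost_bounds(2)[of 1 j' i'] cost_bounds(2)[of 0 i j']
        cost_bounds(2)[of 0 i' j] by linarith
    have "int q dvd (cost 0 i j - (j - i - shift 0)) + (cost 0 i' j' - (j' - i' - shift 0))
        - (cost 0 i j' - (j' - i - shift 0)) - (cost 0 i' j - (j - i' - shift 0))"
      by (intro dvd_add dvd_diff cost_dvd)
    then have "int q dvd D" unfolding D_def by (simp add: algebra_simps)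
    then obtain m where m: "D = int q * m" by (auto elim: dvdE)
    have "m < 0" using neg q unfolding m by (simp add: mult_less_0_iff)
    moreover have "m > - 2"
    proof (rule ccontr)
      assume "\<not> m > - 2"
      then have "int q * m \<le> int q * (- 2)" using q by (intro mult_left_mono) auto
      then show False using lo z q unfolding m by linarith
    qed
    ultimately have "m = - 1" by linarith
    then have D: "D = - int q" using m by simp
    \<comment> \<open>With \<open>D = - q\<close> two turns take \<open>3q - 2z\<close> steps, which
      \<open>lo\<close> bounds by \<open>2q\<close>. Then \<open>cost_two\<close> makes this
      \<open>2q - z\<close>, forcing \<open>z = q\<close>.\<close>
    have "cost 0 i j + cost 1 j i' + cost 0 i' j' + cost 1 j' i + 4 = 4 * int q - 2 * int z + D"
      using e unfolding D_def by linarith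
    then have "4 * int q - 2 * int z + D = 2 * int q - int z"
      using cost_two[OF assms(1) ij] lo D by linarith
    then show False using D z q by linarith
  qed
  \<comment> \<open>Exchanging \<open>j\<close> and \<open>j'\<close> reverses the sign of the
    defect.\<close>
  show ?thesis using ge[OF assms(2-5)] ge[OF assms(2,3,5,4)] by linarith
qed

text \<open>All turns have equal length, so the mixed second difference of the total cost in
  \<open>i\<close> and \<open>j\<close> is 0. For \<open>d > 2\<close> only the step at
  \<open>t\<close> involves both; for \<open>d = 2\<close> level 1 is reduced to level 0 by
  complementary costs.\<close>

lemma cost_separable:
  assumes t: "t < d" and ij: "i \<in> exits t" "i' \<in> exits t" "j \<in> exits (Suc t mod d)" "j' \<in> exits (Suc t mod d)"
  shows "cost t i j + cost t i' j' = cost t i j' + cost t i' j"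
proof (cases "d = 2")
  case True
  then have "t = 0 \<or> t = 1" using t by auto
  then show ?thesis
  proof
    assume "t = 0"
    then show ?thesis using cost_separable_2[OF True] ij True by simp
  next
    assume t1: "t = 1"
    then have ij': "i \<in> exits 1" "i' \<in> exits 1" "j \<in> exits 0" "j' \<in> exits 0" using ij True by simp_all
    show ?thesis
      using cost_separable_2[OF True ij'(3,4,1,2)]
        cost_sum_2[OF True ij'(3,1)] cost_sum_2[OF True ij'(3,2)]
        cost_sum_2[OF True ij'(4,1)] cost_sum_2[OF True ij'(4,2)] unfolding t1 by linarith
  qed
next
  case False
  define t' where "t' = Suc t mod d"
  have "t' < d" using d by (simp add: t'_def)
  have tt: "t' \<noteq> t" using t d by (cases "Suc t = d") (auto simp: t'_def)
  define r where "r s = (SOME x. x \<in> exits s)" for s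
  have r: "r s \<in> exits s" if "s < d" for s
    using exits_nonempty[OF that] some_in_eq by (auto simp: r_def)
  define F where "F i j = r(t := i, t' := j)" for i j
  define G where "G i j s = cost s (F i j s) (F i j (Suc s mod d))" for i j s
  have sum: "(\<Sum>s<d. G i j s) = int (q * d) - int z - int d" if "i \<in> exits t" "j \<in> exits t'" for i j
    unfolding G_def by (rule cost_sum) (use that r in \<open>auto simp: F_def\<close>)
  have zero: "G i j s + G i' j' s - G i j' s - G i' j s = 0" if s: "s < d" "s \<noteq> t" for s
  proof -
    \<comment> \<open>With at least three levels, no step other than \<open>t\<close> joins the two
      levels \<open>t\<close> and \<open>t'\<close>.\<close>
    have "Suc s mod d \<noteq> t'"
      using s t unfolding t'_def by (cases "Suc s = d"; cases "Suc t = d") auto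
    moreover have "s \<noteq> t' \<or> Suc s mod d \<noteq> t"
      using s t False d unfolding t'_def by (cases "Suc s = d"; cases "Suc t = d") auto
    ultimately show ?thesis using s by (auto simp: G_def F_def)
  qed
  have "(\<Sum>s<d. G i j s + G i' j' s - G i j' s - G i' j s) = 0"
    using ij[folded t'_def] by (simp add: sum_subtractf sum.distrib sum)
  moreover have "(\<Sum>s<d. G i j s + G i' j' s - G i j' s - G i' j s)
      = G i j t + G i' j' t - G i j' t - G i' j t"
    using sum.remove[of "{..<d}" t "\<lambda>s. G i j s + G i' j' s - G i j' s - G i' j s"] t zero by simp
  moreover have "G i j t = cost t i j" for i j
    using tt by (simp add: G_def F_def flip: t'_def)
  ultimately show ?thesis by simp
qed

text \<open>Separability makes the exit nearest to one predecessor nearest to all. With the nearest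
  exit \<open>s t\<close> on every level, the costs from \<open>s t\<close> lie between their
  minimum and \<open>q - 1\<close>; this confines the exits to an interval, and
  \<open>cost_sum\<close> gives the slacks the sum \<open>z\<close>.\<close>

lemma interval_data: "\<exists>a \<rho>. interval_data q d z exits a \<rho>"
proof -
  define r where "r s = (SOME x. x \<in> exits s)" for s
  have r: "r s \<in> exits s" if "s < d" for s
    using exits_nonempty[OF that] some_in_eq by (auto simp: r_def)
  have "\<exists>x\<in>exits (Suc t mod d). \<forall>y\<in>exits (Suc t mod d). cost t (r t) x \<le> cost t (r t) y" for t
  proof -
    have "finite (exits (Suc t mod d))"
      by (rule finite_subset[of _ "{0..<int q}"]) (auto simp: exits_def)
    moreover have "exits (Suc t mod d) \<noteq> {}" using d by (intro exits_nonempty) simp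
    ultimately show ?thesis
      using ex_min_if_finite[of "cost t (r t) ` exits (Suc t mod d)"] by (fastforce simp: not_less)
  qed
  then obtain m where m: "\<And>t. m t \<in> exits (Suc t mod d)"
    "\<And>t y. y \<in> exits (Suc t mod d) \<Longrightarrow> cost t (r t) (m t) \<le> cost t (r t) y" by metis
  obtain e where e: "d = Suc e" using d by (cases d) auto
  \<comment> \<open>\<open>m t\<close> lies on the level after \<open>t\<close>, hence the cyclic
    shift of the index.\<close>
  define s where "s t = (case t of 0 \<Rightarrow> m e | Suc u \<Rightarrow> m u)" for t
  have s_next: "s (Suc t mod d) = m t" if "t < d" for t
    using that by (cases "t = e") (auto simp: s_def e)
  have s_in: "s t \<in> exits t" if "t < d" for t
    using m(1)[of e] m(1)[of "t - 1"] that by (cases t) (auto simp: s_def e)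
  \<comment> \<open>Separability transfers minimality from the reference exit \<open>r t\<close> to
    \<open>s t\<close>.\<close>
  have min: "cost t (s t) (s (Suc t mod d)) \<le> cost t (s t) y" if "t < d" "y \<in> exits (Suc t mod d)" for t y
    using cost_separable[OF that(1) s_in[OF that(1)] r[OF that(1)] m(1) that(2)] m(2)[OF that(2)]
    unfolding s_next[OF that(1)] by linarith
  \<comment> \<open>The slack up to the largest possible cost \<open>q - 1\<close>; it becomes the
    value of \<open>a\<close> on the next level.\<close>
  define g where "g t = nat (int q - 1 - cost t (s t) (s (Suc t mod d)))" for t
  have g: "int (g t) = int q - 1 - cost t (s t) (s (Suc t mod d))" for t
    using cost_bounds[of t "s t"] by (simp add: g_def)
  define a where "a t = (case t of 0 \<Rightarrow> g e | Suc u \<Rightarrow> g u)" for t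
  define bs where "bs t = s 0 - (\<Sum>j=1..t. int (a j + 1))" for t
  have "(\<Sum>t<d. int (g t)) = int z"
  proof -
    have "(\<Sum>t<d. int (g t)) = int d * (int q - 1) - (\<Sum>t<d. cost t (s t) (s (Suc t mod d)))"
      by (simp add: g sum_subtractf)
    then show ?thesis using cost_sum[of s] s_in by (simp add: algebra_simps)
  qed
  moreover have "(\<Sum>t<d. a t) = (\<Sum>t<d. g t)"
    unfolding e sum.lessThan_Suc_shift[of a] by (simp add: a_def)
  ultimately have suma: "(\<Sum>t<d. a t) = z" by (metis of_nat_eq_iff of_nat_sum)
  have bs_Suc: "bs (Suc t) = bs t - int (g t) - 1" for t
    by (simp add: bs_def a_def)
  have bs: "int q dvd s t - bs t" if "t < d" for t
    using that
  proof (induction t)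
    case 0
    then show ?case by (simp add: bs_def)
  next
    case (Suc t)
    have sh: "shift t = 0" "Suc t mod d = Suc t" using Suc.prems by (simp_all add: shift_def)
    have "int q dvd (s t - bs t) - (cost t (s t) (s (Suc t)) - (s (Suc t) - s t - shift t)) + int q"
      using Suc by (intro dvd_add[OF dvd_diff[OF _ cost_dvd] dvd_refl]) simp
    also have "\<dots> = s (Suc t) - bs (Suc t)"
      using g[of t] unfolding bs_Suc sh by simp
    finally show ?case .
  qed
  \<comment> \<open>Modulo \<open>q\<close>, the right end \<open>B\<close> is the point just before
    the landing point \<open>s t + shift t\<close>, where the cost is \<open>q - 1\<close>.\<close>
  have mem: "y \<in> cyclic_interval q (B - int (g t)) (g t + 1)"
    if t: "t < d" and y: "y \<in> exits (Suc t mod d)" and B: "int q dvd s t + shift t - 1 - B" for t y B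
  proof -
    define k where "k = nat (cost t (s t) y - cost t (s t) (s (Suc t mod d)))"
    have k: "int k = cost t (s t) y - cost t (s t) (s (Suc t mod d))" using min[OF t y] by (simp add: k_def)
    have "int k \<le> int (g t)" unfolding k g using cost_bounds[of t "s t"] by simp
    then have "k < g t + 1" by simp
    have "int q dvd (cost t (s t) y - (y - s t - shift t)) - (s t + shift t - 1 - B) - int q"
      by (intro dvd_diff cost_dvd B) simp
    also have "\<dots> = (B - int (g t) + int k) - y" unfolding k g by simp
    finally have "(B - int (g t) + int k) mod int q = y mod int q" by (simp add: mod_eq_dvd_iff)
    moreover have "y mod int q = y" using y by (auto simp: exits_def)
    ultimately show ?thesis using \<open>k < g t + 1\<close> unfolding cyclic_interval_def
      by (intro image_eqI[of _ _ k]) auto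
  qed
  have "exits 0 \<subseteq> cyclic_interval q (s 0) (a 0 + 1)"
  proof
    fix y assume y: "y \<in> exits 0"
    have "(\<Sum>j=1..e. int (a j + 1)) = int z - int (g e) + int e"
    proof -
      have "{..<d} = insert 0 {1..e}" using e by auto
      then have "(\<Sum>j<d. int (a j)) = int (a 0) + (\<Sum>j=1..e. int (a j))" by simp
      then have "(\<Sum>j=1..e. int (a j)) = int z - int (g e)"
        using suma by (simp add: a_def flip: of_nat_sum)
      then show ?thesis by (simp add: sum.distrib)
    qed
    then have "bs e = s 0 - (int z - int (g e) + int e)" by (simp only: bs_def)
    moreover have "shift e = int e + 1 + int z" unfolding shift_def using e by simp
    \<comment> \<open>The rotation \<open>d + z\<close> at the last level compensates for the left
      ends moving back along the ring.\<close>
    ultimately have eq: "s e + shift e - 1 - (s 0 + int (g e)) = s e - bs e" by linarith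
    have "int q dvd s e + shift e - 1 - (s 0 + int (g e))" unfolding eq by (rule bs) (simp add: e)
    from mem[OF _ _ this] have "y \<in> cyclic_interval q (s 0 + int (g e) - int (g e)) (g e + 1)"
      using y e by simp
    then show "y \<in> cyclic_interval q (s 0) (a 0 + 1)" by (simp add: a_def)
  qed
  moreover have "exits t \<subseteq> cyclic_interval q (bs t) (a t + 1)" if t: "t \<in> {1..<d}" for t
  proof
    fix y assume y: "y \<in> exits t"
    obtain u where u: "t = Suc u" using t by (cases t) auto
    have "shift u = 0" using t by (simp add: shift_def u)
    then have "y \<in> cyclic_interval q (bs u - 1 - int (g u)) (g u + 1)"
      using bs[of u] y t u by (intro mem) simp_all
    then show "y \<in> cyclic_interval q (bs t) (a t + 1)" by (simp add: a_def u bs_Suc algebra_simps)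
  qed
  moreover have "s 0 \<in> {0..<int q}" using s_in[of 0] d by (auto simp: exits_def)
  ultimately have "interval_data q d z exits a (s 0)"
    unfolding interval_data_def bs_def using suma exits_nonempty d by simp
  then show ?thesis by blast
qed

lemma permutation_similar:
  "permutation_similar I A ({..<d} \<times> {0..<int q}) (cyclic_mat q d (d + z) exits wt)"
proof -
  let ?V = "\<lambda>(t, i). pt (lev t) i" and ?J = "{..<d} \<times> {0..<int q}"
  define \<phi> where "\<phi> = inv_into ?J ?V"
  have bij: "bij_betw \<phi> I ?J" unfolding \<phi>_def by (rule bij_betw_inv_into[OF bij_pt])
  have "A r s = cyclic_mat q d (d + z) exits wt (\<phi> r) (\<phi> s)" if "r \<in> I" "s \<in> I" for r s
  proof -
    have V: "?V (\<phi> x) = x" if "x \<in> I" for x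
      unfolding \<phi>_def using bij_betw_inv_into_right[OF bij_pt that] .
    have "\<phi> r \<in> ?J" "\<phi> s \<in> ?J" using bij that by (auto simp: bij_betw_def)
    then obtain t i t' i' where \<phi>: "\<phi> r = (t, i)" "\<phi> s = (t', i')"
      "t < d" "t' < d" "i \<in> {0..<int q}" "i' \<in> {0..<int q}" by blast
    then have "r = pt (lev t) i" "s = pt (lev t') i'" using V[OF that(1)] V[OF that(2)] by simp_all
    then show ?thesis using matrix_eq[OF \<phi>(3-6)] \<phi> by simp
  qed
  then show ?thesis using bij unfolding permutation_similar_def by blast
qed

end

section \<open>The two directions and the non-uniqueness of the interval data\<close>

lemma trace_pow_walk:
  assumes "M \<in> carrier_mat n n"
  shows "trace_pow M k = (\<Sum>x<n. walk {..<n} (\<lambda>r s. M $$ (r, s)) k x x)"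
  using assms by (simp add: trace_pow_def walk_mat[OF assms])

text \<open>The all-ones vector is fixed by the row sums; this root determines \<open>w\<close> in
  \<open>form_imp_char_poly\<close>.\<close>

lemma stochastic_char_poly_1:
  assumes M: "M \<in> carrier_mat n n" and st: "stochastic_mat M" and n: "n > 0"
  shows "poly (char_poly M) 1 = 0"
proof -
  define v :: "real vec" where "v = vec n (\<lambda>_. 1)"
  have "M *\<^sub>v v = v"
    using M st by (intro eq_vecI) (auto simp: v_def scalar_prod_def stochastic_mat_def lessThan_atLeast0)
  moreover have "v \<noteq> 0\<^sub>v n"
  proof
    assume "v = 0\<^sub>v n"
    then have "v $ 0 = 0\<^sub>v n $ 0" by simp
    then show False using n by (simp add: v_def)
  qed
  ultimately have "eigenvector M v 1" using M by (simp add: eigenvector_def v_def)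
  then show ?thesis using eigenvalue_root_char_poly[OF M] by (auto simp: eigenvalue_def)
qed

lemma char_poly_imp_form:
  assumes "q \<ge> 2" "d \<ge> 2" "1 \<le> z" "z \<le> q - 1" "0 < \<beta>" "\<beta> < 1"
    and M: "M \<in> carrier_mat (q * d) (q * d)" and st: "stochastic_mat M"
    and cp: "char_poly M = target_poly q d z \<beta> w"
  shows "\<exists>S b. (\<exists>a \<rho>. interval_data q d z S a \<rho>) \<and> weight_condition q d \<beta> S b \<and>
    permutation_similar {..<q * d} (\<lambda>r s. M $$ (r, s))
      ({..<d} \<times> {0..<int q}) (cyclic_mat q d (d + z) S b)"
proof -
  have "z < q" using assms by linarith
  then have "char_poly M = target_poly q d z \<beta> w \<longleftrightarrow>
      (\<forall>k\<in>{1..q * d}. trace_pow M k = target_trace q d z \<beta> w k)"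
    using assms by (intro char_poly_eq_target_iff[OF M]) simp_all
  then have tr: "\<forall>k\<in>{1..q * d}. trace_pow M k = target_trace q d z \<beta> w k" using cp by blast
  interpret rigid_matrix "{..<q * d}" "\<lambda>r s. M $$ (r, s)" q d z \<beta> w
  proof
    fix k assume "1 \<le> k" "k \<le> q * d"
    then show "(\<Sum>x<q * d. walk {..<q * d} (\<lambda>r s. M $$ (r, s)) k x x) =
      (if q dvd k then real (q * d) * \<beta> ^ (k div q) else 0)
      + (if k = q * d - z then real (q * d - z) * w else 0)"
      using tr trace_pow_walk[OF M, of k] by (simp add: target_trace_def)
  qed (use assms M st in \<open>auto simp: stochastic_mat_def\<close>)
  show ?thesis using interval_data weight_condition permutation_similar by blast
qed

lemma form_imp_char_poly:
  assumes par: "q \<ge> 2" "d \<ge> 2" "1 \<le> z" "z \<le> q - 1"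
    and M: "M \<in> carrier_mat (q * d) (q * d)" and st: "stochastic_mat M"
    and S: "interval_data q d z S a \<rho>" "weight_condition q d \<beta> S b"
    and perm: "permutation_similar {..<q * d} (\<lambda>r s. M $$ (r, s))
      ({..<d} \<times> {0..<int q}) (cyclic_mat q d (d + z) S b)"
  shows "char_poly M = target_poly q d z \<beta> ((1 - \<beta>) ^ d)"
proof -
  interpret interval_matrix q d z "d + z" \<beta> S b a \<rho>
    by unfold_locales (use par S in auto)
  have "2 * q \<le> q * d" using par by simp
  then have zn: "z < q * d" and zq: "z < q" using par by linarith+
  from perm obtain \<phi> where bij: "bij_betw \<phi> {..<q * d} I"
    and \<phi>: "\<And>r s. r \<in> {..<q * d} \<Longrightarrow> s \<in> {..<q * d} \<Longrightarrow> M $$ (r, s) = A (\<phi> r) (\<phi> s)"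
    unfolding permutation_similar_def I_def by blast
  \<comment> \<open>The trace at this one length serves as the definition of \<open>w\<close>; the
    root 1 of the characteristic polynomial then gives \<open>(1 - \<beta>) ^ d\<close>.\<close>
  define w where "w = trace_pow M (q * d - z) / real (q * d - z)"
  have dvd: "\<not> q dvd q * d - z"
  proof
    assume "q dvd q * d - z"
    then have "q dvd q * d - (q * d - z)" by (rule dvd_diff_nat[OF dvd_triv_left])
    then show False using zn zq par by (auto dest: dvd_imp_le)
  qed
  have "trace_pow M k = target_trace q d z \<beta> w k" if k: "k \<in> {1..q * d}" for k
  proof (cases "k = q * d - z")
    case True
    have "real (q * d - z) \<noteq> 0" using zn by (simp del: of_nat_diff)
    then show ?thesis unfolding True target_trace_def w_def
      using dvd by (simp del: of_nat_diff of_nat_mult)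
  next
    case False
    have "walk {..<q * d} (\<lambda>r s. M $$ (r, s)) k x x = (if q dvd k then \<beta> ^ (k div q) else 0)"
      if x: "x < q * d" for x
    proof -
      have "\<phi> x \<in> I" using bij x by (auto simp: bij_betw_def)
      then show ?thesis
        using walk_bij[of \<phi> "{..<q * d}" I "\<lambda>r s. M $$ (r, s)" A x x k, OF bij \<phi>] closed_walk[of "\<phi> x" k] k False x
        by simp
    qed
    then show ?thesis unfolding trace_pow_walk[OF M] using False by (simp add: target_trace_def)
  qed
  then have cp: "char_poly M = target_poly q d z \<beta> w" using char_poly_eq_target_iff[OF M, of z] par zq by simp
  moreover have "poly (char_poly M) 1 = 0"
    by (rule stochastic_char_poly_1[OF M st]) (use par in simp)
  ultimately have "w = (1 - \<beta>) ^ d" by (simp add: target_poly_def)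
  then show ?thesis using cp by simp
qed

text \<open>Singletons leave slack: all of \<open>z\<close> can sit at level 0, or one unit can move
  to level 1 while \<open>\<rho>\<close> advances by one, which keeps the later left ends in
  place.\<close>

lemma interval_data_not_unique:
  assumes q: "q \<ge> 2" and d: "d \<ge> 2" and z: "1 \<le> z"
  shows "\<exists>S a \<rho> a' \<rho>'. interval_data q d z S a \<rho> \<and> interval_data q d z S a' \<rho>' \<and>
    \<not> (\<rho> = \<rho>' \<and> (\<forall>t<d. a t = a' t))"
proof -
  define S :: "nat \<Rightarrow> int set" where "S t = (if t = 0 then {1} else {(- int t) mod int q})" for t
  define a a' where "a t = (if t = 0 then z else 0)"
    and "a' t = (if t = 0 then z - 1 else if t = 1 then 1 else 0)" for t :: nat
  obtain e where e: "d = Suc (Suc e)" using d by (metis add_2_eq_Suc le_Suc_ex)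
  have sa: "(\<Sum>j=1..t. int (a j + 1)) = int t" for t by (simp add: a_def)
  have sa': "(\<Sum>j=1..t. int (a' j + 1)) = int t + 1" if "t \<ge> 1" for t
    using that by (induction t rule: dec_induct) (simp_all add: a'_def)
  have S: "S t = {(- int t) mod int q}" if "t \<ge> 1" for t using that by (simp add: S_def)
  have "interval_data q d z S a 0"
    unfolding interval_data_def sa
  proof (intro conjI ballI)
    show "(\<Sum>t<d. a t) = z" unfolding e sum.lessThan_Suc_shift by (simp add: a_def)
    show "S 0 \<subseteq> cyclic_interval q 0 (a 0 + 1)"
      using q z by (auto simp: S_def a_def cyclic_interval_def intro!: image_eqI[of _ _ 1])
    fix t assume "t \<in> {1..<d}"
    then show "S t \<subseteq> cyclic_interval q (0 - int t) (a t + 1)"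
      by (auto simp: S a_def cyclic_interval_def)
  qed (use q in \<open>auto simp: S_def\<close>)
  moreover have "interval_data q d z S a' 1"
    unfolding interval_data_def
  proof (intro conjI ballI)
    show "(\<Sum>t<d. a' t) = z" unfolding e sum.lessThan_Suc_shift using z by (simp add: a'_def)
    show "S 0 \<subseteq> cyclic_interval q 1 (a' 0 + 1)"
      using q z by (auto simp: S_def a'_def cyclic_interval_def intro!: image_eqI[of _ _ 0])
    fix t assume t: "t \<in> {1..<d}"
    then show "S t \<subseteq> cyclic_interval q (1 - (\<Sum>j = 1..t. int (a' j + 1))) (a' t + 1)"
      by (subst sa') (auto simp: S a'_def cyclic_interval_def intro!: image_eqI[of _ _ 0])
  qed (use q in \<open>auto simp: S_def\<close>)
  ultimately show ?thesis by (intro exI[of _ S] exI[of _ a] exI[of _ 0] exI[of _ a'] exI[of _ 1]) simp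
qed

theorem theorem4p1:
  fixes q d z n c :: nat and \<alpha> \<beta> :: real
  assumes "q \<ge> 2" and "d \<ge> 2" and "1 \<le> z" and "z \<le> q - 1" and "gcd q z = 1"
    and "0 < \<alpha>" and "\<alpha> < 1"
    and "\<beta> = 1 - \<alpha>" and "n = q * d" and "c = d + z"
  shows "(\<forall>M \<in> carrier_mat n n. stochastic_mat M \<longrightarrow>
      (char_poly M = f_poly q d z \<alpha> \<longleftrightarrow>
        (\<exists>S b. (\<exists>a \<rho>. interval_data q d z S a \<rho>) \<and>
               weight_condition q d \<beta> S b \<and>
               permutation_similar {..<n} (\<lambda>r s. M $$ (r, s))
                 ({..<d} \<times> {0..<int q}) (cyclic_mat q d c S b))))
    \<and> (\<exists>S a \<rho> a' \<rho>'. interval_data q d z S a \<rho> \<and> interval_data q d z S a' \<rho>' \<and>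
           \<not> (\<rho> = \<rho>' \<and> (\<forall>t<d. a t = a' t)))"
proof (rule conjI[OF _ interval_data_not_unique[OF assms(1-3)]], intro ballI impI)
  fix M :: "real mat" assume M: "M \<in> carrier_mat n n" and st: "stochastic_mat M"
  have f: "f_poly q d z \<alpha> = target_poly q d z \<beta> ((1 - \<beta>) ^ d)"
    by (simp add: f_poly_def target_poly_def assms(8))
  have \<beta>: "0 < \<beta>" "\<beta> < 1" using assms by simp_all
  note M' = M[unfolded assms(9)]
  show "char_poly M = f_poly q d z \<alpha> \<longleftrightarrow>
        (\<exists>S b. (\<exists>a \<rho>. interval_data q d z S a \<rho>) \<and>
               weight_condition q d \<beta> S b \<and>
               permutation_similar {..<n} (\<lambda>r s. M $$ (r, s))
                 ({..<d} \<times> {0..<int q}) (cyclic_mat q d c S b))"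
    unfolding f assms(9,10)
    using char_poly_imp_form[OF assms(1-4) \<beta> M' st] form_imp_char_poly[OF assms(1-4) M' st] by blast
qed

end
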